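(* Let $k\ge 1$ be an integer. For $x\ge 3$, \[ \mathcal R_k(x) = \sum_{j=0}^k\frac{\nu_{k-j}}{j!}(\log_2 x)^j + O_k\left(\frac{(\log_2 x)^{k-1}}{\log x}\right), \] where $\nu_j := \nu^{(j)}(0)/j!$ are the Taylor coefficients at $0$ of \[ \nu(z) = \frac{1}{\Gamma(z+1)}\prod_{p}\left(1-\frac{z}{p}\right)^{-1}\left(1-\frac{1}{p}\right)^z . \]
   Context: Throughout, $p$ denotes a prime variable, $\log_2 x=\log\log x$, $\Gamma$ is the Euler gamma function. $\Omega(n)$ is the number of prime factors of $n$ counted with multiplicity, and $\mathcal R_k(x)=\sum_{n\le x,\ \Omega(n)=k} 1/n$ is the reciprocal sum of $k$-almost primes up to $x$. *)

theory Defs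
  imports "HOL-Analysis.Analysis" "HOL-Computational_Algebra.Primes"
begin

definition bigomega :: "nat \<Rightarrow> nat" where
  "bigomega n = size (prime_factorization n)"

definition almost_prime_recip_sum :: "nat \<Rightarrow> real \<Rightarrow> real" where
  "almost_prime_recip_sum k x =
     (\<Sum>n | 0 < n \<and> real n \<le> x \<and> bigomega n = k. 1 / real n)"

(* The product over primes is taken in increasing order, non-primes contributing the factor 1.
   It converges for |z| < 2, which suffices for the derivatives at 0. *)
definition nu :: "complex \<Rightarrow> complex" where
  "nu z = 1 / Gamma (z + 1) *
     (\<Prod>p. if prime p
            then inverse (1 - z / of_nat p) * (1 - 1 / of_nat p) powr z
            else 1)"

definition nu_coeff :: "nat \<Rightarrow> complex" where
  "nu_coeff j = (deriv ^^ j) nu 0 / fact j"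

end

(* Fix a complex z near 0 and put f(n) = z^bigomega(n), S(L) = sum of f(n)/n over n <= e^L and
   T(L) = integral of S over [0, L]. Since f is completely multiplicative, expanding f(n) ln n over
   the prime powers dividing n and using Mertens' first theorem gives
   L S(L) = (1 + z) T(L) + O(|z| sum |f(n)|/n). The sum on the right is O((1 + L)^|z|) by Rankin's
   trick, so T(L) L^(-1-z) converges as L tends to infinity, and S(L) = c L^z + O(|z| L^(3|z|-1)).
   An Abelian argument for the Dirichlet series of f at 1 identifies c = nu(z). The error term is
   holomorphic in z, and Cauchy's inequality on a circle of radius proportional to 1/(1 + ln L)
   bounds its k-th Taylor coefficient, which is the quantity to be estimated; the factor |z|
   accounts for the exponent k - 1 in place of k. *)
theory Submission
  imports Defs "HOL-Number_Theory.Prime_Powers" "HOL-Complex_Analysis.Complex_Analysis" "HOL-Real_Asymp.Real_Asymp"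
begin

subsection \<open>Mertens' first theorem\<close>

text \<open>The error has to be uniform in \<open>z\<close> and to vanish at z = 0, where S is
  constantly 1: Cauchy's inequality divides by r^k, and each lost factor r costs a factor 1 + ln L.
  So the factor |z| is carried through all estimates from the twisted Mertens sum on. T is studied
  instead of S because S jumps at the points ln n, while T is continuous with T' = S elsewhere. The
  relation then reads L T' = (1 + z) T + error, a linear differential equation with integrating
  factor L^(-1-z). The error is O(|z| L^|z|) and |L^(-z)| is at most L^|z|, so the derivative of T
  L^(-1-z) is O(|z| L^(2|z|-2)); integrating and multiplying back by L^z gives the exponent 3|z| -
  1. The surplus L^(3|z|) is bounded on a circle of radius about 1 / (1 + ln L), so no sharper
  exponent is sought. Convergence yields a constant c for each z separately, with no formula and no
  regularity in z. The formula comes from the Dirichlet series at 1 + 1/m for integers m, and the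
  holomorphy of \<open>nu\<close> from the uniformity of the asymptotics.\<close>

text \<open>Substituting n = d m unfolds a summatory function of a Dirichlet convolution. It serves
  both for the identity of \<open>ln\<close> with the divisor sum of \<open>mangoldt\<close> and for
  that identity twisted by \<open>z ^ bigomega n\<close>.\<close>

lemma sum_dvd_swap:
  fixes g :: "nat \<Rightarrow> nat \<Rightarrow> 'a::comm_monoid_add"
  shows "(\<Sum>n=1..N. \<Sum>d | d dvd n. g d (n div d)) = (\<Sum>d=1..N. \<Sum>m=1..N div d. g d m)"
proof -
  have "(\<Sum>n=1..N. \<Sum>d | d dvd n. g d (n div d)) =
        (\<Sum>(n,d)\<in>(SIGMA n:{1..N}. {d. d dvd n}). g d (n div d))"
    by (rule sum.Sigma) auto
  also have "\<dots> = (\<Sum>(d,m)\<in>(SIGMA d:{1..N}. {1..N div d}). g d m)"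
    by (rule sum.reindex_bij_witness[of _ "\<lambda>(d,m). (d * m, d)" "\<lambda>(n,d). (d, n div d)"])
       (auto simp: Suc_le_eq less_eq_div_iff_mult_less_eq mult.commute div_le_mono
             dest: dvd_imp_le dvd_pos_nat order.trans[OF dvd_imp_le])
  also have "\<dots> = (\<Sum>d=1..N. \<Sum>m=1..N div d. g d m)"
    by (rule sum.Sigma [symmetric]) auto
  finally show ?thesis .
qed

lemma bigomega_mult: "m > 0 \<Longrightarrow> n > 0 \<Longrightarrow> bigomega (m * n) = bigomega m + bigomega n"
  by (simp add: bigomega_def prime_factorization_mult)

lemma bigomega_prime: "prime p \<Longrightarrow> bigomega p = 1"
  by (simp add: bigomega_def prime_factorization_prime)

lemma bigomega_1 [simp]: "bigomega (Suc 0) = 0"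
  by (simp add: bigomega_def)

lemma bigomega_ge_1: "n > 1 \<Longrightarrow> bigomega n \<ge> 1"
  by (auto simp: bigomega_def Suc_le_eq prime_factorization_empty_iff intro!: Nat.gr0I)

section \<open>Chebyshev's upper bound and Mertens' estimate\<close>

lemma sum_ln_eq_mangoldt:
  "(\<Sum>n=1..N. ln (real n)) = (\<Sum>d=1..N. mangoldt d * real (N div d))"
proof -
  have "(\<Sum>n=1..N. ln (real n)) = (\<Sum>n=1..N. \<Sum>d | d dvd n. mangoldt d)"
    by (intro sum.cong) (use mangoldt_sum[where ?'a = real] in auto)
  also have "\<dots> = (\<Sum>d=1..N. \<Sum>m=1..N div d. mangoldt d)"
    by (rule sum_dvd_swap)
  finally show ?thesis by (simp add: mult.commute)
qed

lemma sum_ln_eq_ln_fact: "(\<Sum>n=1..N. ln (real n)) = ln (fact N)"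
proof -
  have "ln (prod real {1..N}) = (\<Sum>n=1..N. ln (real n))" by (rule ln_prod) auto
  then show ?thesis by (simp add: fact_prod)
qed

text \<open>Chebyshev's argument: the logarithm of the central binomial coefficient, at most 2m ln
  2, is a sum of \<open>mangoldt d\<close> with weights floor(2m/d) - 2 floor(m/d). These are
  nonnegative, and equal to 1 for m < d \<le> 2m.\<close>

lemma sum_mangoldt_double_le:
  "(\<Sum>d=1..2*m. mangoldt d) \<le> (\<Sum>d=1..m. mangoldt d) + 2 * real m * ln 2"
proof -
  have ext: "(\<Sum>d=1..m. mangoldt d * real (m div d)) = (\<Sum>d=1..2*m. mangoldt d * real (m div d))"
    by (rule sum.mono_neutral_left) (auto simp: div_eq_0_iff)
  have "(\<Sum>d=1..2*m. mangoldt d) - (\<Sum>d=1..m. mangoldt d) = (\<Sum>d\<in>{m<..2*m}. mangoldt d :: real)"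
  proof -
    have "{1..2*m} = {1..m} \<union> {m<..2*m}" by auto
    then have "(\<Sum>d=1..2*m. mangoldt d) = (\<Sum>d=1..m. mangoldt d) + (\<Sum>d\<in>{m<..2*m}. mangoldt d :: real)"
      by (simp add: sum.union_disjoint ivl_disj_int)
    then show ?thesis by simp
  qed
  also have "\<dots> = (\<Sum>d\<in>{m<..2*m}. mangoldt d * (real (2*m div d) - 2 * real (m div d)))"
  proof (rule sum.cong)
    fix d assume d: "d \<in> {m<..2*m}"
    then have "m div d = 0" "2 * m div d = 1"
      by (auto simp: div_eq_0_iff intro!: div_nat_eqI)
    then show "mangoldt d = mangoldt d * (real (2*m div d) - 2 * real (m div d))" by simp
  qed simp
  also have "\<dots> \<le> (\<Sum>d=1..2*m. mangoldt d * (real (2*m div d) - 2 * real (m div d)))"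
  proof (rule sum_mono2)
    fix d
    have "2 * (m div d) \<le> 2 * m div d"
      by (cases "d = 0") (auto simp: less_eq_div_iff_mult_less_eq)
    then have "real (2*m div d) - 2 * real (m div d) \<ge> 0" by linarith
    then show "0 \<le> mangoldt d * (real (2*m div d) - 2 * real (m div d))"
      by (simp add: mangoldt_nonneg)
  qed auto
  also have "\<dots> = (\<Sum>n=1..2*m. ln (real n)) - 2 * (\<Sum>n=1..m. ln (real n))"
    unfolding sum_ln_eq_mangoldt ext
    by (simp add: algebra_simps sum_subtractf sum_distrib_left)
  also have "\<dots> = ln (fact (2*m)) - 2 * ln (fact m)"
    by (simp only: sum_ln_eq_ln_fact)
  also have "\<dots> = ln (real (2*m choose m))"
  proof -
    have "real (2*m choose m) = fact (2*m) / (fact m * fact m)"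
      by (subst binomial_fact) (auto simp: mult_2)
    then show ?thesis by (simp add: ln_div ln_mult)
  qed
  also have "\<dots> \<le> ln (real (2 ^ (2*m)))"
    using binomial_le_pow2[of "2*m" m] by (subst ln_le_cancel_iff) (auto simp del: of_nat_power)
  also have "\<dots> = 2 * real m * ln 2" by (simp add: ln_realpow)
  finally show ?thesis by simp
qed

text \<open>Repeated halving with ln 2 < 1. For n = 2m the bound is 4m + 2m; for n = 2m + 1 the last
  term adds at most n, and 6m + (2m + 1) still fits under 4n.\<close>

lemma sum_mangoldt_le: "(\<Sum>d=1..n. mangoldt d) \<le> 4 * real n"
proof (induction n rule: less_induct)
  case (less n)
  consider "n = 0" | m where "n = 2 * m" "m > 0" | m where "n = 2 * m + 1"
    by (metis evenE oddE gr0I mult_0_right)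
  then show ?case
  proof cases
    case 1 then show ?thesis by simp
  next
    case (2 m)
    then have "(\<Sum>d=1..m. mangoldt d) \<le> 4 * real m" by (intro less) auto
    moreover have "2 * real m * ln 2 \<le> 2 * real m * 1"
      using ln_2_less_1 by (intro mult_left_mono) auto
    then have "2 * real m * ln 2 \<le> 2 * real m" by simp
    ultimately show ?thesis using sum_mangoldt_double_le[of m] 2(1) by (simp only: of_nat_mult of_nat_numeral)
  next
    case (3 m)
    then have "(\<Sum>d=1..m. mangoldt d) \<le> 4 * real m" by (intro less) auto
    moreover have "2 * real m * ln 2 \<le> 2 * real m * 1"
      using ln_2_less_1 by (intro mult_left_mono) auto
    then have "2 * real m * ln 2 \<le> 2 * real m" by simp
    moreover have "(mangoldt n :: real) \<le> real n"
      using mangoldt_le[of n] ln_le_minus_one[of "real n"] 3 by simp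
    moreover have "(\<Sum>d=1..n. mangoldt d) = (\<Sum>d=1..2*m. mangoldt d) + (mangoldt n :: real)"
      using 3 by simp
    ultimately show ?thesis using sum_mangoldt_double_le[of m] 3 by simp
  qed
qed

text \<open>Stirling's formula up to an error n suffices. The lower bound keeps the single term n^n
  / n! of the series for e^n.\<close>

lemma ln_fact_bounds:
  "ln (fact n :: real) \<le> real n * ln (real n)" "ln (fact n :: real) \<ge> real n * ln (real n) - real n"
proof -
  show "ln (fact n :: real) \<le> real n * ln (real n)"
  proof (cases "n = 0")
    case False
    have "(fact n :: real) \<le> real n ^ n" 
      using fact_le_power[of n, where ?'a = real] by simp
    then have "ln (fact n :: real) \<le> ln (real n ^ n)" using False by simp
    with False show ?thesis by (simp add: ln_realpow)
  qed simp
  show "ln (fact n :: real) \<ge> real n * ln (real n) - real n"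
  proof (cases "n = 0")
    case False
    have "real n ^ n / fact n \<le> exp (real n)"
    proof -
      have "(\<lambda>k. real n ^ k /\<^sub>R fact k) sums exp (real n)" by (rule exp_converges)
      then have "(\<Sum>k\<in>{n}. real n ^ k /\<^sub>R fact k) \<le> exp (real n)"
        using sum_le_suminf[of "\<lambda>k. real n ^ k /\<^sub>R fact k" "{n}"] by (auto simp: sums_iff)
      then show ?thesis by (simp add: divide_inverse mult.commute)
    qed
    then have "ln (real n ^ n / fact n) \<le> ln (exp (real n))"
      using False by (subst ln_le_cancel_iff) auto
    with False show ?thesis by (simp add: ln_div ln_realpow)
  qed simp
qed

text \<open>Compare ln n! with n times the sum. Removing the floors costs at most the Chebyshev sum,
  which gives the upper deviation 4; the Stirling error n gives the lower deviation 1.\<close>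

lemma mertens_first:
  assumes "n \<ge> 1"
  shows "\<bar>(\<Sum>d=1..n. mangoldt d / real d) - ln (real n)\<bar> \<le> 4"
proof -
  let ?M = "\<Sum>d=1..n. mangoldt d / real d"
  have eq: "ln (fact n) = (\<Sum>d=1..n. mangoldt d * real (n div d))"
    using sum_ln_eq_mangoldt[of n] sum_ln_eq_ln_fact[of n] by simp
  have "ln (fact n) \<le> (\<Sum>d=1..n. mangoldt d * (real n / real d))"
    unfolding eq by (intro sum_mono mult_left_mono mangoldt_nonneg of_nat_div_le_of_nat)
  also have "\<dots> = real n * ?M" by (simp add: sum_distrib_left mult_ac)
  finally have 1: "ln (fact n) \<le> real n * ?M" .
  have "real n * ?M - (\<Sum>d=1..n. mangoldt d) = (\<Sum>d=1..n. mangoldt d * (real n / real d - 1))"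
    by (simp add: sum_distrib_left algebra_simps sum_subtractf)
  also have "\<dots> \<le> ln (fact n)"
    unfolding eq
  proof (intro sum_mono mult_left_mono mangoldt_nonneg)
    fix d
    show "real n / real d - 1 \<le> real (n div d)"
      using floor_correct[of "real n / real d"] by (simp add: floor_divide_of_nat_eq)
  qed
  finally have 2: "real n * ?M \<le> ln (fact n) + 4 * real n"
    using sum_mangoldt_le[of n] by simp
  have "real n * (?M - ln (real n)) \<le> real n * 4"
    using 2 ln_fact_bounds(1)[of n] by (simp add: algebra_simps)
  moreover have "real n * (-1) \<le> real n * (?M - ln (real n))"
    using 1 ln_fact_bounds(2)[of n] by (simp add: algebra_simps)
  ultimately have "?M - ln (real n) \<le> 4" "-1 \<le> ?M - ln (real n)"
    using assms by (simp_all only: mult_le_cancel_left_pos of_nat_0_less_iff Suc_le_eq One_nat_def)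
  then show ?thesis by linarith
qed

section \<open>Mertens' sum weighted by \<open>z ^ bigomega d\<close>\<close>

lemma sum_inverse_powers_le:
  fixes n :: nat assumes "n \<ge> 2"
  shows "(\<Sum>a=2..N. 1 / real n ^ a) \<le> 2 / real n ^ 2"
proof (cases "N \<ge> 2")
  case True
  have "(\<Sum>a=2..N. (1 / real n) ^ a) = ((1 / real n)^2 - (1 / real n) ^ Suc N) / (1 - 1 / real n)"
    using assms True by (subst sum_gp) auto
  also have "\<dots> \<le> (1 / real n)^2 / (1 - 1 / real n)"
    using assms by (intro divide_right_mono) auto
  also have "\<dots> \<le> (1 / real n)^2 / (1/2)"
    using assms by (intro divide_left_mono) (auto simp: field_simps)
  finally show ?thesis by (simp add: power_divide)
qed auto

lemma summable_ln_over_square: "summable (\<lambda>n. ln (real n) / real n ^ 2)"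
proof (rule summable_comparison_test_bigo)
  show "summable (\<lambda>n. norm (real n powr (-3/2)))"
    by (simp add: summable_real_powr_iff)
  show "(\<lambda>n. ln (real n) / real n ^ 2) \<in> O(\<lambda>n. real n powr (-3/2))"
    by real_asymp
qed

text \<open>Only p^a with a \<ge> 2 contribute, and the sum over a is geometric, leaving a multiple
  of ln p / p^2.\<close>

lemma sum_mangoldt_prime_powers_bounded:
  obtains C where "\<And>n. (\<Sum>d\<in>{d\<in>{1..n}. \<not> prime d}. mangoldt d / real d) \<le> C"
proof
  fix N :: nat
  let ?D = "{d\<in>{1..N}. \<not> prime d \<and> primepow d}"
  let ?h = "\<lambda>(n::nat,a::nat). ln (real n) / real n ^ a"
  \<comment> \<open>\<open>e\<close> recovers (p, k) from p^k, hence is injective on the proper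
    prime powers. Enlarging its image to the square {2..N} x {2..N} discards the primality of
    p.\<close>
  define e where "e = (\<lambda>d::nat. (aprimedivisor d, multiplicity (aprimedivisor d) d))"
  have e: "e d = (p, k)" if "prime p" "k > 0" "d = p ^ k" for d p k
    using that by (simp add: e_def aprimedivisor_prime_power)
  have D: "\<exists>p k. prime p \<and> k \<ge> 2 \<and> d = p ^ k \<and> p \<le> N \<and> k \<le> N" if d: "d \<in> ?D" for d
  proof -
    from d obtain p k where pk: "prime p" "k > 0" "d = p ^ k" by (auto simp: primepow_def)
    with d have "k \<noteq> 1" by auto
    with pk(2) have "k \<ge> 2" by simp
    have "p \<le> d" using pk by (metis dvd_power dvd_imp_le prime_gt_0_nat zero_less_power)
    moreover have "k \<le> d" using pk power_gt_expt[of p k] prime_gt_1_nat[of p] by simp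
    ultimately show ?thesis using pk \<open>k \<ge> 2\<close> d by (intro exI[of _ p] exI[of _ k]) auto
  qed
  have De: "\<exists>p k. e d = (p, k) \<and> d = p ^ k \<and> 2 \<le> p \<and> p \<le> N \<and> 2 \<le> k \<and> k \<le> N \<and>
              mangoldt d / real d = ?h (e d)" if d: "d \<in> ?D" for d
  proof -
    from D[OF d] obtain p k where pk: "prime p" "k \<ge> 2" "d = p ^ k" "p \<le> N" "k \<le> N" by blast
    then have ed: "e d = (p, k)" by (intro e) auto
    have "mangoldt d = ln (real p)" using pk by simp
    with ed pk prime_ge_2_nat[of p] show ?thesis by simp
  qed
  have "(\<Sum>d\<in>{d\<in>{1..N}. \<not> prime d}. mangoldt d / real d) = (\<Sum>d\<in>?D. mangoldt d / real d)"
    by (rule sum.mono_neutral_right) (auto simp: mangoldt_def)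
  also have "\<dots> = (\<Sum>d\<in>?D. ?h (e d))"
  proof (rule sum.cong)
    fix d assume "d \<in> ?D"
    from De[OF this] show "mangoldt d / real d = ?h (e d)" by (elim exE conjE)
  qed simp
  also have "\<dots> = (\<Sum>x\<in>e ` ?D. ?h x)"
  proof (rule sum.reindex [symmetric, unfolded o_def])
    show "inj_on e ?D" 
    proof
      fix x y assume "x \<in> ?D" "y \<in> ?D" "e x = e y"
      from De[OF this(1)] De[OF this(2)] this(3) show "x = y" by (elim exE conjE) simp
    qed
  qed
  also have "\<dots> \<le> (\<Sum>x\<in>{2..N}\<times>{2..N}. ?h x)"
  proof (rule sum_mono2)
    show "e ` ?D \<subseteq> {2..N} \<times> {2..N}"
    proof clarify
      fix d p k assume "d \<in> {1..N}" "\<not> prime d" "primepow d" and ed: "(p, k) = e d"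
      then have "d \<in> ?D" by simp
      from De[OF this] ed show "p \<in> {2..N} \<and> k \<in> {2..N}" by auto
    qed
  qed auto
  also have "\<dots> = (\<Sum>n=2..N. \<Sum>a=2..N. ln (real n) / real n ^ a)"
    by (simp add: sum.cartesian_product)
  also have "\<dots> = (\<Sum>n=2..N. ln (real n) * (\<Sum>a=2..N. 1 / real n ^ a))"
    by (simp add: sum_distrib_left)
  also have "\<dots> \<le> (\<Sum>n=2..N. ln (real n) * (2 / real n ^ 2))"
    by (intro sum_mono mult_left_mono sum_inverse_powers_le) auto
  also have "\<dots> = 2 * (\<Sum>n=2..N. ln (real n) / real n ^ 2)"
    by (simp add: sum_distrib_left mult_ac)
  also have "\<dots> \<le> 2 * (\<Sum>n. ln (real n) / real n ^ 2)"
  proof (intro mult_left_mono sum_le_suminf summable_ln_over_square)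
    fix n show "0 \<le> ln (real n) / real n ^ 2" by (cases "n = 0") auto
  qed auto
  finally show "(\<Sum>d\<in>{d\<in>{1..N}. \<not> prime d}. mangoldt d / real d)
      \<le> 2 * (\<Sum>n. ln (real n) / real n ^ 2)" .
qed

lemma norm_bigomega_power_diff_le:
  assumes "norm (z::complex) \<le> 1" "d > 1"
  shows "norm (z ^ bigomega d - z) \<le> 2 * norm z"
proof -
  have "norm (z ^ bigomega d) \<le> norm z ^ 1"
    using assms bigomega_ge_1[of d] unfolding norm_power by (intro power_decreasing) auto
  with norm_triangle_ineq4[of "z ^ bigomega d" z] show ?thesis by simp
qed

text \<open>At primes \<open>z ^ bigomega d\<close> equals z exactly. At the remaining prime powers
  it differs from z by at most 2|z|, and these have bounded total weight. Thus the error is not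
  merely bounded but proportional to |z|.\<close>

lemma sum_weighted_mangoldt:
  obtains C where "C \<ge> 0" "\<And>(z::complex) n. norm z \<le> 1 \<Longrightarrow> n \<ge> 1 \<Longrightarrow>
    norm ((\<Sum>d=1..n. z ^ bigomega d * mangoldt d / of_nat d) - z * of_real (ln (real n))) \<le> C * norm z"
proof -
  obtain B where B: "\<And>n. (\<Sum>d\<in>{d\<in>{1..n}. \<not> prime d}. mangoldt d / real d) \<le> B"
    using sum_mangoldt_prime_powers_bounded by blast
  have "B \<ge> 0" using B[of 0] by simp
  show thesis
  proof (rule that[of "2 * B + 4"])
    fix z :: complex and n :: nat assume z: "norm z \<le> 1" and n: "n \<ge> 1"
    let ?M = "\<Sum>d=1..n. mangoldt d / real d"
    have M: "complex_of_real ?M = (\<Sum>d=1..n. mangoldt d / of_nat d)" by simp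
    have "(\<Sum>d=1..n. z ^ bigomega d * mangoldt d / of_nat d) - z * of_real ?M =
          (\<Sum>d=1..n. (z ^ bigomega d - z) * (mangoldt d / of_nat d))"
      unfolding M by (simp add: sum_distrib_left algebra_simps sum_subtractf diff_divide_distrib)
    also have "norm \<dots> \<le> (\<Sum>d=1..n. norm ((z ^ bigomega d - z) * (mangoldt d / of_nat d)))"
      by (rule norm_sum)
    also have "\<dots> = (\<Sum>d\<in>{d\<in>{1..n}. \<not> prime d}. norm ((z ^ bigomega d - z) * (mangoldt d / of_nat d)))"
      by (rule sum.mono_neutral_right) (auto simp: bigomega_prime)
    also have "\<dots> \<le> (\<Sum>d\<in>{d\<in>{1..n}. \<not> prime d}. 2 * norm z * (mangoldt d / real d))"
    proof (rule sum_mono)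
      fix d assume d: "d \<in> {d\<in>{1..n}. \<not> prime d}"
      show "norm ((z ^ bigomega d - z) * (mangoldt d / of_nat d)) \<le> 2 * norm z * (mangoldt d / real d)"
      \<comment> \<open>At d = 1 the difference is 1 - z, which is not O(|z|), but
        \<open>mangoldt 1 = 0\<close>.\<close>
      proof (cases "d = 1")
        case False
        with d have "d > 1" by auto
        then show ?thesis
          using norm_bigomega_power_diff_le[OF z, of d] mangoldt_nonneg[of d]
          by (simp add: norm_mult norm_divide mult_right_mono divide_right_mono)
      qed simp
    qed
    also have "\<dots> \<le> 2 * norm z * B"
      unfolding sum_distrib_left[symmetric] using B by (intro mult_left_mono) auto
    finally have 1: "norm ((\<Sum>d=1..n. z ^ bigomega d * mangoldt d / of_nat d) - z * of_real ?M) \<le> 2 * norm z * B" .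
    have "norm (z * of_real ?M - z * of_real (ln (real n))) = norm z * \<bar>?M - ln (real n)\<bar>"
      unfolding right_diff_distrib[symmetric] of_real_diff[symmetric] norm_mult norm_of_real by simp
    also have "\<dots> \<le> norm z * 4"
      using mertens_first[OF n] by (intro mult_left_mono) auto
    finally have 2: "norm (z * of_real ?M - z * of_real (ln (real n))) \<le> norm z * 4" .
    show "norm ((\<Sum>d=1..n. z ^ bigomega d * mangoldt d / of_nat d) - z * of_real (ln (real n)))
        \<le> (2 * B + 4) * norm z"
      using norm_triangle_le[OF add_mono[OF 1 2]] by (simp add: algebra_simps)
  qed (use \<open>B \<ge> 0\<close> in simp)
qed

subsection \<open>Euler products\<close>

text \<open>A sieve: the numbers free of the primes in P split into those also free of q and the
  q-fold of the whole set. By complete multiplicativity the latter part sums to \<open>g q\<close>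
  times the whole, so the factor \<open>1 - g q\<close> removes the multiples of q.\<close>

lemma infsum_coprime_primes:
  fixes g :: "nat \<Rightarrow> complex"
  assumes mult: "\<And>m n. g (m * n) = g m * g n"
  assumes summable: "summable (\<lambda>n. norm (g n))"
  assumes P: "finite P" "\<And>p. p \<in> P \<Longrightarrow> prime p"
  shows "(\<Prod>p\<in>P. 1 - g p) * infsum g UNIV = infsum g {n. \<forall>p\<in>P. \<not> p dvd n}"
  using P
proof (induction P rule: finite_induct)
  case (insert q P)
  have summ: "g summable_on X" for X
    using summable norm_summable_imp_summable_on summable_on_subset_banach by blast
  define A where "A = {n. \<forall>p\<in>P. \<not> p dvd n}"
  define B where "B = {n. \<forall>p\<in>insert q P. \<not> p dvd n}"
  have q: "prime q" using insert by auto
  have A: "A = B \<union> (*) q ` A" "B \<inter> (*) q ` A = {}"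
  proof -
    have "p dvd q * m \<longleftrightarrow> p dvd m" if "p \<in> P" for p m
      using that insert.hyps insert.prems q
      by (metis insertCI prime_dvd_mult_iff primes_dvd_imp_eq)
    then have "q * m \<in> A \<longleftrightarrow> m \<in> A" for m by (simp add: A_def)
    then show "A = B \<union> (*) q ` A" "B \<inter> (*) q ` A = {}"
      by (auto simp: A_def B_def elim!: dvdE[of q])
  qed
  have inj: "inj_on ((*) q) A"
    using q by (auto simp: inj_on_def prime_gt_0_nat)
  have "infsum g A = infsum g B + infsum g ((*) q ` A)"
    by (subst A(1), rule infsum_Un_disjoint) (use summ A(2) in auto)
  also have "infsum g ((*) q ` A) = infsum (\<lambda>n. g q * g n) A"
    by (subst infsum_reindex[OF inj]) (simp add: o_def mult)
  also have "\<dots> = g q * infsum g A"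
    by (rule infsum_cmult_right) (use summ in auto)
  finally have "infsum g A - g q * infsum g A = infsum g B"
    by (rule iffD2[OF diff_eq_eq])
  then have B: "infsum g B = (1 - g q) * infsum g A"
    unfolding left_diff_distrib by simp
  have "(\<Prod>p\<in>insert q P. 1 - g p) * infsum g UNIV = (1 - g q) * infsum g A"
    using insert by (simp add: A_def mult.assoc)
  also note B [symmetric]
  finally show ?case by (simp only: B_def)
qed auto

text \<open>After sieving by the primes up to N, only 1 and numbers beyond N can contribute, so the
  distance from 1 is at most a tail of an absolutely convergent series. The factors
  \<open>1 - g p\<close> stay on the side of the series, so nothing has to be inverted.\<close>

lemma euler_product_LIMSEQ:
  fixes g :: "nat \<Rightarrow> complex"
  assumes mult: "\<And>m n. g (m * n) = g m * g n" and g: "g 0 = 0" "g 1 = 1"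
  assumes summable: "summable (\<lambda>n. norm (g n))"
  shows "(\<lambda>N. (\<Prod>p | prime p \<and> p \<le> N. 1 - g p) * (\<Sum>n. g n)) \<longlonglongrightarrow> 1"
proof -
  have summ: "g summable_on X" for X
    using summable norm_summable_imp_summable_on summable_on_subset_banach by blast
  have nsumm: "(\<lambda>n. norm (g n)) summable_on X" for X
    using summable summable_on_UNIV_nonneg_real_iff summable_on_subset_banach
    by (metis norm_ge_zero subset_UNIV)
  have total: "infsum g UNIV = (\<Sum>n. g n)"
    using has_sum_imp_sums[OF has_sum_infsum[OF summ]] by (simp add: sums_iff)
  have ntotal: "(\<lambda>n. norm (g n)) sums infsum (\<lambda>n. norm (g n)) UNIV"
    using has_sum_imp_sums[OF has_sum_infsum[OF nsumm]] by simp
  let ?R = "\<lambda>N. infsum (\<lambda>n. norm (g n)) UNIV - (\<Sum>n\<in>{..N}. norm (g n))"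
  have "?R \<longlonglongrightarrow> infsum (\<lambda>n. norm (g n)) UNIV - infsum (\<lambda>n. norm (g n)) UNIV"
    using ntotal by (intro tendsto_intros) (simp add: sums_def_le)
  then have R: "?R \<longlonglongrightarrow> 0" by simp
  have "norm ((\<Prod>p | prime p \<and> p \<le> N. 1 - g p) * (\<Sum>n. g n) - 1) \<le> ?R N" for N
  proof -
    let ?A = "{n. \<forall>p\<in>{p. prime p \<and> p \<le> N}. \<not> p dvd n}"
    have 1: "1 \<in> ?A" by (auto dest: prime_nat_iff[THEN iffD1])
    \<comment> \<open>For N < 2 nothing is sieved and 0 survives; it is harmless since
      \<open>g 0 = 0\<close>.\<close>
    have tail: "?A - {1} - {0} \<subseteq> - {..N}"
    proof
      fix n assume n: "n \<in> ?A - {1} - {0}"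
      then obtain p where p: "prime p" "p dvd n" using prime_factor_nat[of n] by auto
      have "n > 0" using n by simp
      with p(2) have "p \<le> n" by (rule dvd_imp_le)
      moreover have "\<not> p \<le> N" using n p by blast
      ultimately show "n \<in> - {..N}" by simp
    qed
    have "(\<Prod>p | prime p \<and> p \<le> N. 1 - g p) * (\<Sum>n. g n) = infsum g ?A"
      unfolding total[symmetric] by (rule infsum_coprime_primes[OF mult summable]) auto
    also have "\<dots> = infsum g ({1} \<union> (?A - {1}))"
      using 1 by (simp add: insert_absorb)
    also have "\<dots> = 1 + infsum g (?A - {1})"
      by (subst infsum_Un_disjoint) (use summ g in auto)
    also have "infsum g (?A - {1}) = infsum g (?A - {1} - {0})"
      by (rule infsum_cong_neutral) (use g in auto)
    finally have "norm ((\<Prod>p | prime p \<and> p \<le> N. 1 - g p) * (\<Sum>n. g n) - 1)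
        = norm (infsum g (?A - {1} - {0}))" by simp
    also have "\<dots> \<le> infsum (\<lambda>n. norm (g n)) (?A - {1} - {0})"
      by (rule norm_infsum_bound) (rule nsumm)
    also have "\<dots> \<le> infsum (\<lambda>n. norm (g n)) (- {..N})"
      by (rule infsum_mono2) (use tail nsumm in auto)
    also have "\<dots> = infsum (\<lambda>n. norm (g n)) UNIV - infsum (\<lambda>n. norm (g n)) {..N}"
      unfolding Compl_eq_Diff_UNIV by (rule infsum_Diff) (use nsumm in auto)
    finally show ?thesis by simp
  qed
  then have "(\<lambda>N. (\<Prod>p | prime p \<and> p \<le> N. 1 - g p) * (\<Sum>n. g n) - 1) \<longlonglongrightarrow> 0"
    by (intro Lim_null_comparison[OF _ R]) auto
  then show ?thesis by (simp add: LIM_zero_iff)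
qed

section \<open>The zeta function just to the right of 1\<close>

text \<open>The Riemann zeta function at 1 + s; the term n = 0 vanishes because
  \<open>0 powr a = 0\<close>.\<close>

definition zeta1 :: "real \<Rightarrow> real" where
  "zeta1 s = (\<Sum>n. real n powr (-(1 + s)))"

lemma summable_zeta1: "s > 0 \<Longrightarrow> summable (\<lambda>n. real n powr (-(1 + s)))"
  by (simp add: summable_real_powr_iff)

lemma powr_diff_bounds:
  fixes s x :: real
  assumes "s > 0" "x > 0"
  shows "s * (x + 1) powr (-(1 + s)) \<le> x powr (-s) - (x + 1) powr (-s)"
        "x powr (-s) - (x + 1) powr (-s) \<le> s * x powr (-(1 + s))"
proof -
  have "\<exists>y>x. y < x + 1 \<and> (x + 1) powr (-s) - x powr (-s) = (x + 1 - x) * ((-s) * y powr (-s - 1))"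
  proof (rule MVT2[of x "x + 1" "\<lambda>y. y powr (-s)" "\<lambda>y. (-s) * y powr (-s - 1)"])
    fix y assume "x \<le> y" "y \<le> x + 1"
    then have "y > 0" using assms by linarith
    then show "((\<lambda>y. y powr (-s)) has_real_derivative (-s) * y powr (-s - 1)) (at y)"
      by (rule has_real_derivative_powr)
  qed simp
  then obtain y where y: "x < y" "y < x + 1"
    and eq: "(x + 1) powr (-s) - x powr (-s) = (-s) * y powr (-s - 1)" by auto
  have eq': "x powr (-s) - (x + 1) powr (-s) = s * y powr (-(1 + s))"
  proof -
    have "- s - 1 = - (1 + s)" by simp
    with eq show ?thesis by simp
  qed
  show "s * (x + 1) powr (-(1 + s)) \<le> x powr (-s) - (x + 1) powr (-s)"
       "x powr (-s) - (x + 1) powr (-s) \<le> s * x powr (-(1 + s))"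
    unfolding eq' using assms y by (auto intro!: mult_left_mono powr_mono2')
qed

text \<open>Up to the factor s, the terms interlace with the differences n^(-s) - (n+1)^(-s), which
  telescope to 1. This captures the simple pole with residue 1 by real means.\<close>

lemma zeta1_bounds:
  assumes s: "s > 0"
  shows "1 / s \<le> zeta1 s" "zeta1 s \<le> 1 + 1 / s"
proof -
  have lim: "(\<lambda>n. - (real (Suc n) powr (-s))) \<longlonglongrightarrow> - 0"
    using s by (intro tendsto_intros) real_asymp
  have tele: "(\<lambda>n. real (Suc n) powr (-s) - real (Suc (Suc n)) powr (-s)) sums 1"
    using telescope_sums[OF lim] by simp
  have summ: "summable (\<lambda>n. real n powr (-(1 + s)))" by (rule summable_zeta1) fact
  have eq1: "zeta1 s = (\<Sum>n. real (Suc n) powr (-(1 + s)))"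
    unfolding zeta1_def using suminf_split_head[OF summ] by simp
  have summ1: "summable (\<lambda>n. real (Suc n) powr (-(1 + s)))"
    using summ by (subst summable_Suc_iff)
  have eq2: "zeta1 s = 1 + (\<Sum>n. real (Suc (Suc n)) powr (-(1 + s)))"
    unfolding eq1 using suminf_split_head[OF summ1] by simp
  have summ2: "summable (\<lambda>n. real (Suc (Suc n)) powr (-(1 + s)))"
    using summ1 by (subst summable_Suc_iff)
  have "1 \<le> (\<Sum>n. s * real (Suc n) powr (-(1 + s)))"
    using tele powr_diff_bounds(2)[OF s, of "real (Suc _)"]
    by (intro sums_le[OF _ tele summable_sums] summable_mult summ1) (auto simp: add_ac)
  also have "\<dots> = s * zeta1 s" unfolding eq1 by (rule suminf_mult[OF summ1])
  finally show "1 / s \<le> zeta1 s" using s by (simp add: field_simps)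
  have "s * (\<Sum>n. real (Suc (Suc n)) powr (-(1 + s))) = (\<Sum>n. s * real (Suc (Suc n)) powr (-(1 + s)))"
    by (rule suminf_mult[OF summ2, symmetric])
  also have "\<dots> \<le> 1"
    using powr_diff_bounds(1)[OF s, of "real (Suc _)"]
    by (intro sums_le[OF _ summable_sums tele] summable_mult summ2) (auto simp: add_ac)
  finally show "zeta1 s \<le> 1 + 1 / s" unfolding eq2 using s by (simp add: field_simps)
qed

section \<open>Euler product of the Dirichlet series of \<open>z ^ bigomega n\<close>\<close>

definition omega_dirichlet :: "complex \<Rightarrow> real \<Rightarrow> complex" where
  "omega_dirichlet z s = (\<Sum>n. z ^ bigomega n * of_real (real n powr (-(1 + s))))"

text \<open>A logarithm of the local factor (1 - z u)^(-1) (1 - u)^z with u = p^(-1-s); at s = 0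
  this is the factor in \<open>nu\<close>. The value 0 at non-primes allows summation over all
  p.\<close>

definition euler_log :: "complex \<Rightarrow> real \<Rightarrow> nat \<Rightarrow> complex" where
  "euler_log z s p = (if prime p then
     z * of_real (ln (1 - real p powr (-(1 + s)))) - ln (1 - z * of_real (real p powr (-(1 + s)))) else 0)"

lemma prime_powr_le_half:
  assumes "prime p" "s \<ge> 0"
  shows "real p powr (-(1 + s)) \<le> 1 / real p" "real p powr (-(1 + s)) \<le> 1 / 2" "real p powr (-(1 + s)) > 0"
proof -
  have p: "real p \<ge> 2" using prime_ge_2_nat[OF assms(1)] by simp
  have "real p powr (-(1 + s)) \<le> real p powr (-1)" using assms p by (intro powr_mono) auto
  also have "\<dots> = 1 / real p" using p by (simp add: powr_minus_divide)
  finally show 1: "real p powr (-(1 + s)) \<le> 1 / real p" .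
  also have "\<dots> \<le> 1 / 2" using p by (simp add: field_simps)
  finally show "real p powr (-(1 + s)) \<le> 1 / 2" .
  show "real p powr (-(1 + s)) > 0" using p by simp
qed

text \<open>Both logarithms have linear term -z u, which cancels, and each quadratic remainder is at
  most 2 u^2. The bound is uniform in s and includes s = 0, as needed for the passage to the
  limit.\<close>

lemma norm_euler_log_le:
  assumes z: "norm z \<le> 1" and s: "s \<ge> 0"
  shows "norm (euler_log z s p) \<le> 4 / real p ^ 2"
proof (cases "prime p")
  case True
  define u where "u = real p powr (-(1 + s))"
  have u: "u > 0" "u \<le> 1/2" "u \<le> 1 / real p"
    using prime_powr_le_half[OF True s] by (auto simp: u_def)
  have le: "norm (ln (1 - w) + w) \<le> 2 * u ^ 2" if w: "norm w \<le> u" for w :: complex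
  proof -
    have "norm (ln (1 + (- w)) - (- w)) \<le> norm (- w) ^ 2 / (1 - norm (- w))"
      using w u by (intro Ln_approx_linear) auto
    also have "\<dots> \<le> u ^ 2 / (1 / 2)"
      using w u by (intro frac_le power_mono) auto
    finally show ?thesis by simp
  qed
  have l: "of_real (ln (1 - u)) = ln (1 - complex_of_real u)"
    using u by (subst Ln_of_real[symmetric]) auto
  have "euler_log z s p = z * (ln (1 - of_real u) + of_real u) - (ln (1 - z * of_real u) + z * of_real u)"
    using True unfolding euler_log_def u_def[symmetric] l by (simp add: algebra_simps)
  also have "norm \<dots> \<le> norm z * (2 * u ^ 2) + 2 * u ^ 2"
    using u z le[of "of_real u"] le[of "z * of_real u"]
    by (intro norm_triangle_le_diff add_mono) (auto simp: norm_mult mult_left_le_one_le intro!: mult_left_mono)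
  also have "\<dots> \<le> 1 * (2 * u ^ 2) + 2 * u ^ 2"
    using z by (intro add_mono mult_right_mono) auto
  also have "\<dots> = 4 * u ^ 2" by simp
  also have "\<dots> \<le> 4 * (1 / real p) ^ 2"
    using u by (intro mult_left_mono power_mono) auto
  finally show ?thesis by (simp add: power_divide)
qed (simp add: euler_log_def)

lemma summable_inverse_square: "summable (\<lambda>n. 4 / real n ^ 2)"
  using summable_mult[OF inverse_power_summable[of 2, where ?'a = real], of 4]
  by (simp add: divide_inverse)

lemma summable_euler_log:
  assumes "norm z \<le> 1" "s \<ge> 0"
  shows "summable (euler_log z s)"
  by (rule summable_comparison_test[OF _ summable_inverse_square]) (use norm_euler_log_le[OF assms] in auto)

lemma exp_euler_log:
  assumes "norm z \<le> 1" "s \<ge> 0" "prime p"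
  shows "exp (euler_log z s p) * (1 - z * of_real (real p powr (-(1 + s)))) =
         exp (z * of_real (ln (1 - real p powr (-(1 + s)))))"
proof -
  define u where "u = real p powr (-(1 + s))"
  have u: "u > 0" "u \<le> 1/2"
    using prime_powr_le_half[OF assms(3,2)] by (auto simp: u_def)
  have "norm (z * of_real u) \<le> 1 * (1/2)"
    unfolding norm_mult using assms u by (intro mult_mono) auto
  then have "1 - z * of_real u \<noteq> 0" by auto
  then show ?thesis using assms unfolding euler_log_def u_def[symmetric] by (simp add: exp_diff)
qed

lemma omega_dirichlet_euler:
  assumes z: "norm z \<le> 1" and s: "s > 0"
  shows "(\<lambda>N. (\<Prod>p | prime p \<and> p \<le> N. 1 - z * of_real (real p powr (-(1 + s)))) * omega_dirichlet z s) \<longlonglongrightarrow> 1"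
    "summable (\<lambda>n. norm (z ^ bigomega n * of_real (real n powr (-(1 + s)))))"
proof -
  let ?g = "\<lambda>n. z ^ bigomega n * complex_of_real (real n powr (-(1 + s)))"
  have "norm (?g n) \<le> 1 * real n powr (-(1 + s))" for n
    unfolding norm_mult norm_power using z by (intro mult_mono) (auto intro: power_le_one)
  then show summ: "summable (\<lambda>n. norm (?g n))"
    by (intro summable_comparison_test[OF _ summable_zeta1[OF s]]) auto
  have "?g (m * n) = ?g m * ?g n" for m n
    by (cases "m = 0 \<or> n = 0") (auto simp: bigomega_mult power_add powr_mult)
  then have "(\<lambda>N. (\<Prod>p | prime p \<and> p \<le> N. 1 - ?g p) * (\<Sum>n. ?g n)) \<longlonglongrightarrow> 1"
    by (intro euler_product_LIMSEQ summ) auto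
  then show "(\<lambda>N. (\<Prod>p | prime p \<and> p \<le> N. 1 - z * of_real (real p powr (-(1 + s)))) * omega_dirichlet z s) \<longlonglongrightarrow> 1"
    unfolding omega_dirichlet_def by (simp add: bigomega_prime del: minus_add_distrib cong: prod.cong_simp)
qed

lemma sum_euler_log: "(\<Sum>p\<le>N. euler_log z s p) = (\<Sum>p | prime p \<and> p \<le> N. euler_log z s p)"
  by (rule sum.mono_neutral_right) (auto simp: euler_log_def)

lemma zeta1_pos: "s > 0 \<Longrightarrow> zeta1 s > 0"
  using zeta1_bounds(1)[of s] by (smt (verit) divide_pos_pos)

text \<open>The series behaves like the z-th power of zeta times a product that still converges at s
  = 0. The Euler products for z and for 1 are compared factor by factor; the one for 1 is real and
  positive, so the z-th power involves only a real logarithm.\<close>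

lemma omega_dirichlet_eq:
  assumes z: "norm z \<le> 1" and s: "s > 0"
  shows "omega_dirichlet z s = exp (\<Sum>p. euler_log z s p) * exp (z * of_real (ln (zeta1 s)))"
proof -
  let ?u = "\<lambda>p::nat. real p powr (-(1 + s))"
  let ?l = "\<lambda>N. \<Sum>p | prime p \<and> p \<le> N. ln (1 - ?u p)"
  have u: "0 < ?u p" "?u p \<le> 1/2" if "prime p" for p
    using prime_powr_le_half[OF that, of s] s by auto
  have od1: "omega_dirichlet 1 s = of_real (zeta1 s)"
    using suminf_of_real[OF summable_zeta1[OF s], where ?'a = complex]
    by (simp add: omega_dirichlet_def zeta1_def)
  have "(\<lambda>N. (\<Prod>p | prime p \<and> p \<le> N. 1 - 1 * complex_of_real (?u p)) * of_real (zeta1 s)) \<longlonglongrightarrow> 1"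
    using omega_dirichlet_euler(1)[of 1 s] s od1 by simp
  then have "(\<lambda>N. complex_of_real ((\<Prod>p | prime p \<and> p \<le> N. 1 - ?u p) * zeta1 s)) \<longlonglongrightarrow> of_real 1"
    by simp
  then have "(\<lambda>N. (\<Prod>p | prime p \<and> p \<le> N. 1 - ?u p) * zeta1 s) \<longlonglongrightarrow> 1"
    by (subst (asm) tendsto_of_real_iff)
  then have "(\<lambda>N. (\<Prod>p | prime p \<and> p \<le> N. 1 - ?u p) * zeta1 s / zeta1 s) \<longlonglongrightarrow> 1 / zeta1 s"
    using zeta1_pos[OF s] by (intro tendsto_intros) auto
  then have "(\<lambda>N. \<Prod>p | prime p \<and> p \<le> N. 1 - ?u p) \<longlonglongrightarrow> 1 / zeta1 s"
    using zeta1_pos[OF s] by simp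
  then have "(\<lambda>N. ln (\<Prod>p | prime p \<and> p \<le> N. 1 - ?u p)) \<longlonglongrightarrow> ln (1 / zeta1 s)"
    using zeta1_pos[OF s] by (intro tendsto_ln) auto
  moreover have "ln (\<Prod>p | prime p \<and> p \<le> N. 1 - ?u p) = ?l N" for N
  proof (rule ln_prod)
    fix p assume "p \<in> {p. prime p \<and> p \<le> N}"
    then show "1 - ?u p \<noteq> 0" using u(2)[of p] by simp
  qed simp
  ultimately have l: "?l \<longlonglongrightarrow> - ln (zeta1 s)"
    using zeta1_pos[OF s] by (simp add: ln_div)
  have eq: "(\<Prod>p | prime p \<and> p \<le> N. 1 - z * of_real (?u p)) * omega_dirichlet z s =
     exp (z * of_real (?l N)) / exp (\<Sum>p\<le>N. euler_log z s p) * omega_dirichlet z s" for N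
  proof -
    have "exp (\<Sum>p\<le>N. euler_log z s p) * (\<Prod>p | prime p \<and> p \<le> N. 1 - z * of_real (?u p)) =
      (\<Prod>p | prime p \<and> p \<le> N. exp (euler_log z s p) * (1 - z * of_real (?u p)))"
      unfolding sum_euler_log by (simp add: exp_sum prod.distrib)
    also have "\<dots> = (\<Prod>p | prime p \<and> p \<le> N. exp (z * of_real (ln (1 - ?u p))))"
      by (rule prod.cong) (use exp_euler_log[OF z, of s] s in auto)
    also have "\<dots> = exp (z * of_real (?l N))"
      by (simp add: exp_sum[symmetric] sum_distrib_left)
    finally show ?thesis by (simp add: field_simps)
  qed
  have "(\<lambda>N. exp (z * of_real (?l N)) / exp (\<Sum>p\<le>N. euler_log z s p) * omega_dirichlet z s)
    \<longlonglongrightarrow> exp (z * of_real (- ln (zeta1 s))) / exp (\<Sum>p. euler_log z s p) * omega_dirichlet z s"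
    using z s by (intro tendsto_intros l summable_LIMSEQ' summable_euler_log) auto
  moreover have "(\<lambda>N. exp (z * of_real (?l N)) / exp (\<Sum>p\<le>N. euler_log z s p) * omega_dirichlet z s) \<longlonglongrightarrow> 1"
    using omega_dirichlet_euler(1)[OF z s] unfolding eq .
  ultimately have "exp (z * of_real (- ln (zeta1 s))) / exp (\<Sum>p. euler_log z s p) * omega_dirichlet z s = 1"
    by (rule LIMSEQ_unique)
  then show ?thesis by (simp add: field_simps exp_minus)
qed

text \<open>Rankin's trick: the exponent is perturbed by \<open>1 / L\<close>.\<close>
lemma bigomega_sum_le:
  obtains K where "K \<ge> 1" "\<And>r L. 0 \<le> r \<Longrightarrow> r \<le> 1 \<Longrightarrow> L > 0 \<Longrightarrow>
    (\<Sum>n=1..nat \<lfloor>exp L\<rfloor>. r ^ bigomega n / real n) \<le> K * (1 + L) powr r"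
proof
  define B where "B = (\<Sum>n. 4 / real n ^ 2)"
  have B: "B \<ge> 0" unfolding B_def by (rule suminf_nonneg[OF summable_inverse_square]) auto
  show "exp (1 + B) \<ge> 1" using B by simp
  fix r L :: real assume r: "0 \<le> r" "r \<le> 1" and L: "L > 0"
  let ?z = "complex_of_real r" and ?s = "1 / L"
  have z: "norm ?z \<le> 1" and s: "?s > 0" using r L by auto
  have summ: "summable (\<lambda>n. r ^ bigomega n * real n powr (-(1 + ?s)))"
    using omega_dirichlet_euler(2)[OF z s] r by (simp add: norm_mult norm_power)
  have "(\<Sum>n=1..nat \<lfloor>exp L\<rfloor>. r ^ bigomega n / real n)
     \<le> (\<Sum>n=1..nat \<lfloor>exp L\<rfloor>. exp 1 * (r ^ bigomega n * real n powr (-(1 + ?s))))"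
  proof (rule sum_mono)
    fix n assume n: "n \<in> {1..nat \<lfloor>exp L\<rfloor>}"
    then have "real n \<le> exp L" by (simp add: le_nat_iff le_floor_iff)
    then have "ln (real n) \<le> L" using n ln_le_cancel_iff[of "real n" "exp L"] by simp
    \<comment> \<open>For n \<le> e^L the inserted factor n^(-1/L) is at least 1/e, so completing
      the sum to a series costs only a factor e.\<close>
    then have "exp (- 1) \<le> exp (-(ln (real n) / L))" using L by (simp add: field_simps)
    also have "\<dots> = real n powr (- ?s)" using n by (simp add: powr_def)
    finally have "1 \<le> exp 1 * real n powr (- ?s)" by (simp add: exp_minus field_simps)
    then have "1 / real n \<le> exp 1 * real n powr (- ?s) / real n" 
      by (rule divide_right_mono) simp
    also have "\<dots> = exp 1 * real n powr (- (1 + ?s))"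
      using n by (simp add: powr_diff powr_minus powr_add field_simps)
    finally have "r ^ bigomega n * (1 / real n) \<le> r ^ bigomega n * (exp 1 * real n powr (- (1 + ?s)))"
      using r by (intro mult_left_mono) auto
    then show "r ^ bigomega n / real n \<le> exp 1 * (r ^ bigomega n * real n powr (-(1 + ?s)))"
      by (simp add: mult_ac)
  qed
  also have "\<dots> = exp 1 * (\<Sum>n=1..nat \<lfloor>exp L\<rfloor>. r ^ bigomega n * real n powr (-(1 + ?s)))"
    by (simp add: sum_distrib_left)
  also have "\<dots> \<le> exp 1 * (\<Sum>n. r ^ bigomega n * real n powr (-(1 + ?s)))"
    using r by (intro mult_left_mono sum_le_suminf summ) auto
  also have "(\<Sum>n. r ^ bigomega n * real n powr (-(1 + ?s))) \<le> norm (omega_dirichlet ?z ?s)"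
    unfolding omega_dirichlet_def of_real_power[symmetric] of_real_mult[symmetric]
      suminf_of_real[OF summ, symmetric] norm_of_real by (rule abs_ge_self)
  also have "norm (omega_dirichlet ?z ?s) = exp (Re (\<Sum>p. euler_log ?z ?s p)) * zeta1 ?s powr r"
    unfolding omega_dirichlet_eq[OF z s] norm_mult norm_exp_eq_Re
    using zeta1_pos[OF s] by (simp add: powr_def)
  also have "\<dots> \<le> exp B * (1 + L) powr r"
  proof (intro mult_mono)
    have "Re (\<Sum>p. euler_log ?z ?s p) \<le> norm (\<Sum>p. euler_log ?z ?s p)" by (rule complex_Re_le_cmod)
    also have "\<dots> \<le> B" unfolding B_def
      using s by (intro norm_suminf_le summable_inverse_square norm_euler_log_le z) auto
    finally show "exp (Re (\<Sum>p. euler_log ?z ?s p)) \<le> exp B" by simp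
    \<comment> \<open>At s = 1/L the pole bound 1 + 1/s is 1 + L.\<close>
    show "zeta1 ?s powr r \<le> (1 + L) powr r"
      using zeta1_bounds(2)[OF s] zeta1_pos[OF s] r by (intro powr_mono2) auto
  qed auto
  finally show "(\<Sum>n=1..nat \<lfloor>exp L\<rfloor>. r ^ bigomega n / real n) \<le> exp (1 + B) * (1 + L) powr r"
    by (simp add: exp_add mult_ac)
qed

subsection \<open>The summatory function of \<open>z ^ bigomega n / n\<close>\<close>

definition omega_sum :: "complex \<Rightarrow> real \<Rightarrow> complex" where
  "omega_sum z L = (\<Sum>n=1..nat \<lfloor>exp L\<rfloor>. z ^ bigomega n / of_nat n)"

text \<open>The integral of \<open>omega_sum z\<close> over [0, L] evaluated termwise, n being
  counted from ln n on. In this closed form the recurrence is pure algebra.\<close>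

definition omega_int :: "complex \<Rightarrow> real \<Rightarrow> complex" where
  "omega_int z L = (\<Sum>n=1..nat \<lfloor>exp L\<rfloor>. z ^ bigomega n / of_nat n * of_real (L - ln (real n)))"

section \<open>The recurrence between \<open>omega_sum\<close> and \<open>omega_int\<close>\<close>

lemma le_nat_floor_exp_iff:
  assumes "n > 0"
  shows "n \<le> nat \<lfloor>exp L\<rfloor> \<longleftrightarrow> ln (real n) \<le> L"
proof -
  have "n \<le> nat \<lfloor>exp L\<rfloor> \<longleftrightarrow> real n \<le> exp L"
    by (simp add: le_nat_iff le_floor_iff)
  also have "\<dots> \<longleftrightarrow> ln (real n) \<le> L"
    using assms ln_le_cancel_iff[of "real n" "exp L"] by simp
  finally show ?thesis .
qed

text \<open>Both roundings together lose at most a factor 2. With N the floor of e^L and q = N div d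
  \<ge> 1, one has q d \<le> e^L < N + 1 \<le> (q + 1) d \<le> 2 q d, and ln 2 < 1.\<close>

lemma ln_div_approx:
  assumes d: "d \<in> {1..nat \<lfloor>exp L\<rfloor>}"
  shows "nat \<lfloor>exp L\<rfloor> div d \<ge> 1"
    "\<bar>ln (real (nat \<lfloor>exp L\<rfloor> div d)) - (L - ln (real d))\<bar> \<le> 1"
proof -
  define N where "N = nat \<lfloor>exp L\<rfloor>"
  define q where "q = N div d"
  have "real N = of_int \<lfloor>exp L\<rfloor>" by (simp add: N_def)
  then have N: "real N \<le> exp L" "exp L < real N + 1" by linarith+
  have q: "q \<ge> 1" using d div_greater_zero_iff[of N d] by (simp add: q_def N_def Suc_le_eq)
  then show "nat \<lfloor>exp L\<rfloor> div d \<ge> 1" by (simp add: q_def N_def)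
  have d0: "d > 0" using d by simp
  have "q * d \<le> N" by (simp add: q_def)
  then have "real (q * d) \<le> exp L" using N(1) by linarith
  then have "ln (real (q * d)) \<le> ln (exp L)" using q d0 by (subst ln_le_cancel_iff) auto
  then have 1: "ln (real q) \<le> L - ln (real d)" using q d0 by (simp add: ln_mult)
  have "N < (q + 1) * d"
    unfolding q_def using dividend_less_div_times[OF d0, of N] by (simp add: algebra_simps)
  then have "N + 1 \<le> 2 * q * d" using q
    using mult_le_mono1[of "q + 1" "2 * q" d] by linarith
  then have "real (N + 1) \<le> real (2 * q * d)" by (simp only: of_nat_le_iff)
  then have "exp L \<le> real (2 * q * d)" using N(2) by linarith
  then have "ln (exp L) \<le> ln (real (2 * q * d))" by (subst ln_le_cancel_iff) (use q d0 in auto)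
  also have "\<dots> = ln 2 + ln (real q) + ln (real d)" using q d0 by (simp add: ln_mult)
  finally have "L - ln (real d) \<le> ln (real q) + 1" using ln_2_less_1 by simp
  with 1 show "\<bar>ln (real (nat \<lfloor>exp L\<rfloor> div d)) - (L - ln (real d))\<bar> \<le> 1"
    by (simp add: q_def N_def)
qed

lemma mangoldt_sum_codivisor:
  assumes "n > 0"
  shows "(\<Sum>d | d dvd n. mangoldt (n div d) :: complex) = of_real (ln (real n))"
proof -
  have "(\<Sum>d | d dvd n. mangoldt (n div d) :: complex) = (\<Sum>d | d dvd n. mangoldt d)"
    by (rule sum.reindex_bij_witness[of _ "\<lambda>d. n div d" "\<lambda>d. n div d"]) (use assms in auto)
  with mangoldt_sum[of n, where ?'a = complex] assms show ?thesis by simp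
qed

text \<open>The left side is the sum weighted by ln n, as L - (L - ln n) = ln n. Writing ln n as the
  sum of \<open>mangoldt (n div d)\<close> and splitting \<open>z ^ bigomega n\<close> leaves as
  inner sum exactly the twisted Mertens sum.\<close>

lemma omega_sum_recurrence:
  "omega_sum z L * of_real L - omega_int z L =
     (\<Sum>d=1..nat \<lfloor>exp L\<rfloor>. z ^ bigomega d / of_nat d *
        (\<Sum>m=1..nat \<lfloor>exp L\<rfloor> div d. z ^ bigomega m * mangoldt m / of_nat m))"
proof -
  define N where "N = nat \<lfloor>exp L\<rfloor>"
  have "omega_sum z L * of_real L - omega_int z L =
      (\<Sum>n=1..N. z ^ bigomega n / of_nat n * of_real (ln (real n)))"
    unfolding omega_sum_def omega_int_def N_def
    by (simp only: sum_distrib_right sum_subtractf[symmetric] right_diff_distrib[symmetric]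
          of_real_diff[symmetric]) simp
  also have "\<dots> = (\<Sum>n=1..N. \<Sum>d | d dvd n. z ^ bigomega d / of_nat d *
      (z ^ bigomega (n div d) * mangoldt (n div d) / of_nat (n div d)))"
  proof (rule sum.cong)
    fix n assume n: "n \<in> {1..N}"
    then have "z ^ bigomega n / of_nat n * of_real (ln (real n)) =
       (\<Sum>d | d dvd n. z ^ bigomega n / of_nat n * mangoldt (n div d))"
      by (simp add: mangoldt_sum_codivisor[symmetric] sum_distrib_left)
    also have "\<dots> = (\<Sum>d | d dvd n. z ^ bigomega d / of_nat d *
        (z ^ bigomega (n div d) * mangoldt (n div d) / of_nat (n div d)))"
    proof (rule sum.cong)
      fix d assume "d \<in> {d. d dvd n}"
      then obtain m where m: "n = d * m" by (auto elim: dvdE)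
      with n have "d > 0" "m > 0" by auto
      then show "z ^ bigomega n / of_nat n * mangoldt (n div d) = z ^ bigomega d / of_nat d *
        (z ^ bigomega (n div d) * mangoldt (n div d) / of_nat (n div d))"
        by (simp add: m bigomega_mult power_add)
    qed simp
    finally show "z ^ bigomega n / of_nat n * of_real (ln (real n)) = (\<Sum>d | d dvd n. z ^ bigomega d / of_nat d *
        (z ^ bigomega (n div d) * mangoldt (n div d) / of_nat (n div d)))" .
  qed simp
  also have "\<dots> = (\<Sum>d=1..N. \<Sum>m=1..N div d. z ^ bigomega d / of_nat d * (z ^ bigomega m * mangoldt m / of_nat m))"
    by (rule sum_dvd_swap)
  also have "\<dots> = (\<Sum>d=1..N. z ^ bigomega d / of_nat d * (\<Sum>m=1..N div d. z ^ bigomega m * mangoldt m / of_nat m))"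
    by (simp only: sum_distrib_left)
  finally show ?thesis by (simp only: N_def)
qed

text \<open>The inner Mertens sum is z (L - ln d) + O(|z|), and its main parts add up to z times
  \<open>omega_int z L\<close>. In the constant, B comes from the twisted Mertens estimate, 1 from
  rounding, and K from Rankin's bound at r = |z|.\<close>

lemma omega_sum_bounds:
  obtains C where "C \<ge> 0"
    "\<And>z L. norm z \<le> 1 \<Longrightarrow> L > 0 \<Longrightarrow> norm (omega_sum z L) \<le> C * (1 + L) powr norm z"
    "\<And>z L. norm z \<le> 1 \<Longrightarrow> L > 0 \<Longrightarrow>
      norm (omega_sum z L * of_real L - (1 + z) * omega_int z L) \<le> C * norm z * (1 + L) powr norm z"
proof -
  obtain K where K: "K \<ge> 1" "\<And>r L. 0 \<le> r \<Longrightarrow> r \<le> 1 \<Longrightarrow> L > 0 \<Longrightarrow>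
    (\<Sum>n=1..nat \<lfloor>exp L\<rfloor>. r ^ bigomega n / real n) \<le> K * (1 + L) powr r"
    using bigomega_sum_le by metis
  obtain B where B: "B \<ge> 0" "\<And>(z::complex) n. norm z \<le> 1 \<Longrightarrow> n \<ge> 1 \<Longrightarrow>
    norm ((\<Sum>d=1..n. z ^ bigomega d * mangoldt d / of_nat d) - z * of_real (ln (real n))) \<le> B * norm z"
    using sum_weighted_mangoldt by metis
  show thesis
  proof (rule that[of "(B + 1) * K"])
    show "(B + 1) * K \<ge> 0" using B K by simp
    fix z :: complex and L :: real assume z: "norm z \<le> 1" and L: "L > 0"
    have A: "(\<Sum>n=1..nat \<lfloor>exp L\<rfloor>. norm (z ^ bigomega n / of_nat n)) \<le> K * (1 + L) powr norm z"
      using K(2)[of "norm z" L] z L by (simp add: norm_divide norm_power)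
    have "norm (omega_sum z L) \<le> (\<Sum>n=1..nat \<lfloor>exp L\<rfloor>. norm (z ^ bigomega n / of_nat n))"
      unfolding omega_sum_def by (rule norm_sum)
    also note A
    also have "K * (1 + L) powr norm z \<le> ((B + 1) * K) * (1 + L) powr norm z"
      using K B by (intro mult_right_mono) (auto simp: algebra_simps)
    finally show "norm (omega_sum z L) \<le> (B + 1) * K * (1 + L) powr norm z" .
    let ?G = "\<lambda>n. \<Sum>m=1..n. z ^ bigomega m * mangoldt m / of_nat m"
    let ?N = "nat \<lfloor>exp L\<rfloor>"
    have "omega_sum z L * of_real L - (1 + z) * omega_int z L =
        (omega_sum z L * of_real L - omega_int z L) - z * omega_int z L" by (simp add: algebra_simps)
    also have "\<dots> = (\<Sum>d=1..?N. z ^ bigomega d / of_nat d * (?G (?N div d) - z * of_real (L - ln (real d))))"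
      unfolding omega_sum_recurrence unfolding omega_int_def
      by (simp only: sum_distrib_left sum_subtractf[symmetric] right_diff_distrib mult_ac)
    also have "norm \<dots> \<le> (\<Sum>d=1..?N. norm (z ^ bigomega d / of_nat d) * ((B + 1) * norm z))"
    proof (rule sum_norm_le)
      fix d assume d: "d \<in> {1..?N}"
      let ?q = "?N div d"
      have "norm (?G ?q - z * of_real (L - ln (real d))) =
        norm ((?G ?q - z * of_real (ln (real ?q))) + z * of_real (ln (real ?q) - (L - ln (real d))))"
        by (simp add: algebra_simps)
      also have "\<dots> \<le> B * norm z + norm z * 1"
      proof (intro norm_triangle_le add_mono)
        show "norm (?G ?q - z * of_real (ln (real ?q))) \<le> B * norm z"
          using B(2)[OF z] ln_div_approx(1)[OF d] by blast
        show "norm (z * of_real (ln (real ?q) - (L - ln (real d)))) \<le> norm z * 1"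
          unfolding norm_mult norm_of_real using ln_div_approx(2)[OF d] by (intro mult_left_mono) auto
      qed
      finally have "norm (?G ?q - z * of_real (L - ln (real d))) \<le> (B + 1) * norm z"
        by (simp add: algebra_simps)
      then show "norm (z ^ bigomega d / of_nat d * (?G (?N div d) - z * of_real (L - ln (real d))))
          \<le> norm (z ^ bigomega d / of_nat d) * ((B + 1) * norm z)"
        unfolding norm_mult by (intro mult_left_mono) auto
    qed
    also have "\<dots> = (\<Sum>d=1..?N. norm (z ^ bigomega d / of_nat d)) * ((B + 1) * norm z)"
      by (simp only: sum_distrib_right)
    also have "\<dots> \<le> (K * (1 + L) powr norm z) * ((B + 1) * norm z)"
      using A B by (intro mult_right_mono) auto
    finally show "norm (omega_sum z L * of_real L - (1 + z) * omega_int z L)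
        \<le> (B + 1) * K * norm z * (1 + L) powr norm z"
      by (simp add: mult_ac)
  qed
qed

section \<open>\<open>omega_int\<close> as an antiderivative of \<open>omega_sum\<close>\<close>

text \<open>Below b the range of summation no longer depends on L, so continuity and derivatives can
  be taken term by term.\<close>

lemma omega_int_eq_max:
  assumes "L \<le> b"
  shows "omega_int z L = (\<Sum>n=1..nat \<lfloor>exp b\<rfloor>. z ^ bigomega n / of_nat n * of_real (max 0 (L - ln (real n))))"
proof -
  have "omega_int z L = (\<Sum>n=1..nat \<lfloor>exp L\<rfloor>. z ^ bigomega n / of_nat n * of_real (max 0 (L - ln (real n))))"
    unfolding omega_int_def by (rule sum.cong) (auto simp: le_nat_floor_exp_iff max_def)
  also have "\<dots> = (\<Sum>n=1..nat \<lfloor>exp b\<rfloor>. z ^ bigomega n / of_nat n * of_real (max 0 (L - ln (real n))))"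
  proof (rule sum.mono_neutral_left)
    show "{1..nat \<lfloor>exp L\<rfloor>} \<subseteq> {1..nat \<lfloor>exp b\<rfloor>}"
      using assms by (intro atLeastatMost_subset_iff[THEN iffD2] disjI2 conjI nat_mono floor_mono) auto
  qed (auto simp: le_nat_floor_exp_iff max_def not_le)
  finally show ?thesis .
qed

lemma omega_sum_eq_if:
  assumes "L \<le> b"
  shows "omega_sum z L = (\<Sum>n=1..nat \<lfloor>exp b\<rfloor>. z ^ bigomega n / of_nat n * (if ln (real n) \<le> L then 1 else 0))"
proof -
  have "omega_sum z L = (\<Sum>n=1..nat \<lfloor>exp L\<rfloor>. z ^ bigomega n / of_nat n * (if ln (real n) \<le> L then 1 else 0))"
    unfolding omega_sum_def by (rule sum.cong) (auto simp: le_nat_floor_exp_iff)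
  also have "\<dots> = (\<Sum>n=1..nat \<lfloor>exp b\<rfloor>. z ^ bigomega n / of_nat n * (if ln (real n) \<le> L then 1 else 0))"
  proof (rule sum.mono_neutral_left)
    show "{1..nat \<lfloor>exp L\<rfloor>} \<subseteq> {1..nat \<lfloor>exp b\<rfloor>}"
      using assms by (intro atLeastatMost_subset_iff[THEN iffD2] disjI2 conjI nat_mono floor_mono) auto
  qed (auto simp: le_nat_floor_exp_iff not_le)
  finally show ?thesis .
qed

lemma continuous_on_omega_int: "continuous_on {a..b} (omega_int z)"
proof -
  have "continuous_on {a..b} (\<lambda>L. \<Sum>n=1..nat \<lfloor>exp b\<rfloor>. z ^ bigomega n / of_nat n * of_real (max 0 (L - ln (real n))))"
    by (intro continuous_intros)
  then show ?thesis
    by (rule continuous_on_eq) (rule omega_int_eq_max[symmetric], simp)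
qed

text \<open>The excluded points are the kinks of the piecewise linear terms. There are finitely many
  below b, so the fundamental theorem of calculus tolerates them.\<close>

lemma omega_int_has_vector_derivative:
  assumes "L < b" "L \<notin> (\<lambda>n. ln (real n)) ` {1..nat \<lfloor>exp b\<rfloor>}"
  shows "(omega_int z has_vector_derivative omega_sum z L) (at L)"
proof -
  have max: "((\<lambda>L. max 0 (L - c)) has_real_derivative (if c \<le> L then 1 else 0)) (at L)" if "L \<noteq> c" for c :: real
  proof (cases "c < L")
    case True
    have "((\<lambda>L. L - c) has_real_derivative 1) (at L)" by (auto intro!: derivative_eq_intros)
    then have "((\<lambda>L. max 0 (L - c)) has_real_derivative 1) (at L)"
      by (rule has_field_derivative_transform_within_open[of _ _ _ "{c<..}"]) (use True in auto)
    with True show ?thesis by simp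
  next
    case False
    have "((\<lambda>L. 0) has_real_derivative 0) (at L)" by simp
    then have "((\<lambda>L. max 0 (L - c)) has_real_derivative 0) (at L)"
      by (rule has_field_derivative_transform_within_open[of _ _ _ "{..<c}"]) (use False that in auto)
    with False that show ?thesis by simp
  qed
  have "((\<lambda>L. \<Sum>n=1..nat \<lfloor>exp b\<rfloor>. z ^ bigomega n / of_nat n * of_real (max 0 (L - ln (real n))))
     has_vector_derivative (\<Sum>n=1..nat \<lfloor>exp b\<rfloor>. z ^ bigomega n / of_nat n *
       of_real (if ln (real n) \<le> L then 1 else 0))) (at L)"
    using assms(2)
    by (intro has_vector_derivative_sum has_vector_derivative_mult_right has_vector_derivative_of_real max) auto
  also have "(\<Sum>n=1..nat \<lfloor>exp b\<rfloor>. z ^ bigomega n / of_nat n * of_real (if ln (real n) \<le> L then 1 else 0)) = omega_sum z L"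
    using assms(1) by (subst omega_sum_eq_if[of L b]) (auto intro!: sum.cong)
  finally show ?thesis
  proof (rule has_vector_derivative_transform_within_open[of _ _ _ "{..<b}"])
    fix y assume "y \<in> {..<b}"
    then show "(\<Sum>n=1..nat \<lfloor>exp b\<rfloor>. z ^ bigomega n / of_nat n * of_real (max 0 (y - ln (real n)))) = omega_int z y"
      by (intro omega_int_eq_max[symmetric]) auto
  qed (use assms(1) in auto)
qed

text \<open>The hypothesis forces \<phi> to increase, to its limit 0, so V inherits the Cauchy
  property. Letting b tend to infinity turns the bound on increments into a rate of
  convergence.\<close>

lemma convergent_of_majorant:
  fixes V :: "real \<Rightarrow> complex" and \<phi> :: "real \<Rightarrow> real"
  assumes V: "\<And>a b. 1 \<le> a \<Longrightarrow> a \<le> b \<Longrightarrow> norm (V b - V a) \<le> \<phi> b - \<phi> a"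
    and \<phi>: "(\<phi> \<longlongrightarrow> 0) at_top"
  shows "\<exists>c. \<forall>L\<ge>1. norm (V L - c) \<le> - \<phi> L"
proof -
  have \<phi>n: "(\<lambda>n. \<phi> (real n)) \<longlonglongrightarrow> 0"
    by (rule filterlim_compose[OF \<phi> filterlim_real_sequentially])
  have le: "norm (V (real m) - V (real n)) \<le> \<bar>\<phi> (real m) - \<phi> (real n)\<bar>" if "m \<ge> 1" "n \<ge> 1" for m n
    using that V[of "real m" "real n"] V[of "real n" "real m"]
    by (cases "m \<le> n") (auto simp: norm_minus_commute)
  have "Cauchy (\<lambda>n. V (real n))"
  proof (rule CauchyI)
    fix e :: real assume "e > 0"
    from CauchyD[OF LIMSEQ_imp_Cauchy[OF \<phi>n] this] obtain M where
      "\<forall>m\<ge>M. \<forall>n\<ge>M. norm (\<phi> (real m) - \<phi> (real n)) < e" by blast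
    then have "\<forall>m\<ge>max 1 M. \<forall>n\<ge>max 1 M. norm (V (real m) - V (real n)) < e"
      using le by (metis max.bounded_iff order.strict_trans1 real_norm_def)
    then show "\<exists>M. \<forall>m\<ge>M. \<forall>n\<ge>M. norm (V (real m) - V (real n)) < e" by blast
  qed
  then obtain c where c: "(\<lambda>n. V (real n)) \<longlonglongrightarrow> c"
    using Cauchy_convergent_iff convergent_def by metis
  have "norm (V L - c) \<le> - \<phi> L" if L: "L \<ge> 1" for L
  proof (rule tendsto_le[OF sequentially_bot])
    show "(\<lambda>n. norm (V L - V (real n))) \<longlonglongrightarrow> norm (V L - c)" by (intro tendsto_intros c)
    show "(\<lambda>n. \<phi> (real n) - \<phi> L) \<longlonglongrightarrow> - \<phi> L" using tendsto_diff[OF \<phi>n tendsto_const[of "\<phi> L"]] by simp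
    show "\<forall>\<^sub>F n in sequentially. norm (V L - V (real n)) \<le> \<phi> (real n) - \<phi> L"
      using eventually_ge_at_top[of "nat \<lceil>L\<rceil>"]
    proof eventually_elim
      case (elim n)
      then have "L \<le> real n" by linarith
      from V[OF L this] show ?case by (simp add: norm_minus_commute)
    qed
  qed
  then show ?thesis by blast
qed

definition omega_ratio :: "complex \<Rightarrow> real \<Rightarrow> complex" where
  "omega_ratio z L = omega_int z L * exp (-(1 + z) * of_real (ln L))"

lemma norm_exp_mult_ln: "L > 0 \<Longrightarrow> norm (exp (z * of_real (ln L))) = L powr Re z"
  by (simp add: norm_exp_eq_Re powr_def)

lemma has_vector_derivative_exp_ln:
  fixes w :: complex
  assumes "L > 0"
  shows "((\<lambda>L. exp (w * of_real (ln L))) has_vector_derivative w * exp (w * of_real (ln L)) * of_real (1 / L)) (at L)"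
proof -
  have "((\<lambda>u. exp (w * u)) has_field_derivative w * exp (w * of_real (ln L))) (at (complex_of_real (ln L)))"
    by (auto intro!: derivative_eq_intros)
  moreover have "((\<lambda>L. complex_of_real (ln L)) has_vector_derivative of_real (1 / L)) (at L)"
    using assms by (intro has_vector_derivative_of_real) (auto intro!: derivative_eq_intros)
  ultimately show ?thesis
    using field_vector_diff_chain_at[of "\<lambda>L. complex_of_real (ln L)" "of_real (1 / L)" L "\<lambda>u. exp (w * u)"]
    by (simp add: o_def mult_ac)
qed

lemma one_plus_powr_le:
  fixes L r :: real
  assumes "1 \<le> L" "0 \<le> r" "r \<le> 1"
  shows "(1 + L) powr r \<le> 2 * L powr r"
proof -
  have "(1 + L) powr r \<le> (2 * L) powr r" using assms by (intro powr_mono2) auto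
  also have "\<dots> = 2 powr r * L powr r" using assms by (simp add: powr_mult)
  also have "\<dots> \<le> 2 powr 1 * L powr r" using assms by (intro mult_right_mono powr_mono) auto
  finally show ?thesis by simp
qed

text \<open>The product rule gives the derivative (L S - (1 + z) T) L^(-2-z), of size |z|
  L^(2|z|-2). The right side is the increment of an antiderivative of that majorant; its negative
  sign reflects 2|z| - 1 < 0.\<close>

lemma omega_ratio_diff_le:
  obtains C where "C \<ge> 0" "\<And>z a b. norm z \<le> 1/4 \<Longrightarrow> 1 \<le> a \<Longrightarrow> a \<le> b \<Longrightarrow>
    norm (omega_ratio z b - omega_ratio z a) \<le>
      (- (C * norm z) * b powr (2 * norm z - 1)) - (- (C * norm z) * a powr (2 * norm z - 1))"
proof -
  obtain C where C: "C \<ge> 0" "\<And>z L. norm z \<le> 1 \<Longrightarrow> L > 0 \<Longrightarrow>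
      norm (omega_sum z L * of_real L - (1 + z) * omega_int z L) \<le> C * norm z * (1 + L) powr norm z"
    using omega_sum_bounds by metis
  show thesis
  proof (rule that[of "4 * C"])
    fix z :: complex and a b :: real assume z: "norm z \<le> 1/4" and ab: "1 \<le> a" "a \<le> b"
    define r where "r = norm z"
    have r: "0 \<le> r" "r \<le> 1/4" using z by (auto simp: r_def)
    let ?V = "\<lambda>L. (omega_sum z L * of_real L - (1 + z) * omega_int z L) * (exp (-(1 + z) * of_real (ln L)) * of_real (1 / L))"
    let ?\<phi> = "\<lambda>L. - (4 * C * r) * L powr (2 * r - 1)"
    let ?\<phi>' = "\<lambda>L. - (4 * C * r) * ((2 * r - 1) * L powr (2 * r - 1 - 1))"
    let ?S = "(\<lambda>n. ln (real n)) ` {1..nat \<lfloor>exp b\<rfloor>}"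
    have "(?V has_integral (omega_ratio z b - omega_ratio z a)) {a..b}"
    proof (rule fundamental_theorem_of_calculus_interior_strong[of ?S])
      show "continuous_on {a..b} (omega_ratio z)"
        unfolding omega_ratio_def using ab by (intro continuous_intros continuous_on_omega_int) auto
      fix L assume L: "L \<in> {a<..<b} - ?S"
      then have "L > 0" using ab by auto
      have "(omega_ratio z has_vector_derivative (omega_int z L * (-(1 + z) * exp (-(1 + z) * of_real (ln L)) * of_real (1 / L))
          + omega_sum z L * exp (-(1 + z) * of_real (ln L)))) (at L)"
        unfolding omega_ratio_def
        by (intro has_vector_derivative_mult omega_int_has_vector_derivative[of _ b] has_vector_derivative_exp_ln)
           (use L \<open>L > 0\<close> in auto)
      also have "omega_int z L * (-(1 + z) * exp (-(1 + z) * of_real (ln L)) * of_real (1 / L))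
          + omega_sum z L * exp (-(1 + z) * of_real (ln L)) = ?V L"
        using \<open>L > 0\<close> by (simp add: field_simps)
      finally show "(omega_ratio z has_vector_derivative ?V L) (at L)" .
    qed (use ab in auto)
    moreover have "(?\<phi>' has_integral (?\<phi> b - ?\<phi> a)) {a..b}"
    proof (rule fundamental_theorem_of_calculus)
      fix L assume "L \<in> {a..b}"
      then have "L > 0" using ab by auto
      then have "(?\<phi> has_real_derivative ?\<phi>' L) (at L)"
        by (intro DERIV_cmult has_real_derivative_powr)
      then show "(?\<phi> has_vector_derivative ?\<phi>' L) (at L within {a..b})"
        by (metis has_real_derivative_iff_has_vector_derivative has_vector_derivative_at_within)
    qed (use ab in auto)
    moreover have "norm (?V L) \<le> ?\<phi>' L" if "L \<in> {a..b}" for L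
    proof -
      have L: "L \<ge> 1" using that ab by auto
      have "norm (?V L) \<le> (C * r * (1 + L) powr r) * (L powr (- (1 + Re z)) * (1 / L))"
        unfolding norm_mult[of _ "exp _ * _"]
      proof (rule mult_mono)
        show "norm (omega_sum z L * of_real L - (1 + z) * omega_int z L) \<le> C * r * (1 + L) powr r"
          using C(2)[of z L] r L by (simp add: r_def)
        show "norm (exp (- (1 + z) * of_real (ln L)) * of_real (1 / L)) \<le> L powr (- (1 + Re z)) * (1 / L)"
          using L norm_exp_mult_ln[of L "-(1 + z)"] unfolding norm_mult norm_of_real by simp
      qed (use C r in auto)
      also have "\<dots> \<le> (C * r * (2 * L powr r)) * (L powr (- (1 - r)) * (1 / L))"
      proof (intro mult_mono)
        show "(1 + L) powr r \<le> 2 * L powr r" using L r by (intro one_plus_powr_le) auto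
        have "- Re z \<le> r" unfolding r_def using abs_Re_le_cmod[of z] by linarith
        then show "L powr (- (1 + Re z)) \<le> L powr (- (1 - r))" using L by (intro powr_mono) auto
      qed (use C r L in auto)
      also have "\<dots> = C * r * 2 * (L powr r * L powr (- (1 - r)) * L powr (-1))"
        using L by (simp add: powr_minus_divide)
      also have "L powr r * L powr (- (1 - r)) * L powr (-1) = L powr (2 * r - 1 - 1)"
        unfolding powr_add[symmetric] by (simp add: algebra_simps)
      \<comment> \<open>As r \<le> 1/4, the factor 1 - 2r from differentiating is at least 1/2; this
        is the origin of 4 in \<open>4 * C\<close>.\<close>
      also have "C * r * 2 * L powr (2 * r - 1 - 1) \<le> C * r * (4 * (1 - 2 * r)) * L powr (2 * r - 1 - 1)"
        using C r by (intro mult_left_mono mult_right_mono) auto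
      also have "\<dots> = ?\<phi>' L" by (simp add: algebra_simps)
      finally show ?thesis .
    qed
    ultimately have "norm (omega_ratio z b - omega_ratio z a) \<le> ?\<phi> b - ?\<phi> a"
      by (metis (no_types, lifting) has_integral_iff integral_norm_bound_integral)
    then show "norm (omega_ratio z b - omega_ratio z a) \<le>
      (- (4 * C * norm z) * b powr (2 * norm z - 1)) - (- (4 * C * norm z) * a powr (2 * norm z - 1))"
      by (simp only: r_def)
  qed (use C in simp)
qed

text \<open>Dividing the recurrence by L expresses S through the convergent ratio, so the leading
  constant is (1 + z) times its limit. The two errors have exponents |z| - 1 and (2|z| - 1) + |z|. C
  is uniform in z, while c is still unidentified.\<close>

lemma omega_sum_asymp_ex:
  "\<exists>C\<ge>0. \<forall>z. norm z \<le> 1/4 \<longrightarrow> (\<exists>c. \<forall>L\<ge>1.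
     norm (omega_sum z L - c * exp (z * of_real (ln L))) \<le> C * norm z * L powr (3 * norm z - 1))"
proof -
  obtain C where C: "C \<ge> 0" "\<And>z L. norm z \<le> 1 \<Longrightarrow> L > 0 \<Longrightarrow>
      norm (omega_sum z L * of_real L - (1 + z) * omega_int z L) \<le> C * norm z * (1 + L) powr norm z"
    using omega_sum_bounds by metis
  obtain B where B: "B \<ge> 0" "\<And>z a b. norm z \<le> 1/4 \<Longrightarrow> 1 \<le> a \<Longrightarrow> a \<le> b \<Longrightarrow>
    norm (omega_ratio z b - omega_ratio z a) \<le>
      (- (B * norm z) * b powr (2 * norm z - 1)) - (- (B * norm z) * a powr (2 * norm z - 1))"
    using omega_ratio_diff_le by metis
  show ?thesis
  proof (intro exI[of _ "2 * B + 2 * C"] conjI allI impI)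
    fix z :: complex assume z: "norm z \<le> 1/4"
    define r where "r = norm z"
    have r: "0 \<le> r" "r \<le> 1/4" using z by (auto simp: r_def)
    have "((\<lambda>L. - (B * norm z) * L powr (2 * norm z - 1)) \<longlongrightarrow> 0) at_top"
      using z by (intro tendsto_mult_right_zero tendsto_neg_powr filterlim_ident) auto
    from convergent_of_majorant[of "omega_ratio z", OF B(2)[OF z] this]
    obtain c where c: "\<And>L. L \<ge> 1 \<Longrightarrow> norm (omega_ratio z L - c) \<le> B * r * L powr (2 * r - 1)"
      by (auto simp: r_def)
    have "norm (omega_sum z L - ((1 + z) * c) * exp (z * of_real (ln L))) \<le> (2 * B + 2 * C) * norm z * L powr (3 * norm z - 1)"
      if L: "L \<ge> 1" for L
    proof -
      have expL: "exp (of_real (ln L)) = complex_of_real L" using L by (simp add: exp_of_real)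
      have int: "omega_int z L = omega_ratio z L * (of_real L * exp (z * of_real (ln L)))"
      proof -
        have "exp (-(1 + z) * of_real (ln L)) * (exp (of_real (ln L)) * exp (z * of_real (ln L))) = 1"
          by (simp add: exp_add[symmetric] algebra_simps)
        then show ?thesis by (simp add: omega_ratio_def expL mult.assoc)
      qed
      have "omega_sum z L - ((1 + z) * c) * exp (z * of_real (ln L)) =
         (omega_sum z L * of_real L - (1 + z) * omega_int z L) / of_real L
         + (1 + z) * (omega_ratio z L - c) * exp (z * of_real (ln L))"
        using L unfolding int by (simp add: field_simps)
      also have "norm \<dots> \<le> C * r * (2 * L powr r) / L + 2 * (B * r * L powr (2 * r - 1)) * L powr r"
      proof (intro norm_triangle_le add_mono)
        have "norm (omega_sum z L * of_real L - (1 + z) * omega_int z L) \<le> C * r * (1 + L) powr r"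
          using C(2)[of z L] r L by (simp add: r_def)
        also have "\<dots> \<le> C * r * (2 * L powr r)"
        proof (intro mult_left_mono)
          show "(1 + L) powr r \<le> 2 * L powr r" using L r by (intro one_plus_powr_le) auto
        qed (use C r in auto)
        finally show "norm ((omega_sum z L * of_real L - (1 + z) * omega_int z L) / of_real L) \<le> C * r * (2 * L powr r) / L"
          using L by (simp add: norm_divide divide_right_mono)
        have "norm (1 + z) \<le> 2" using norm_triangle_ineq[of 1 z] z by simp
        moreover have "L powr Re z \<le> L powr r"
          using L complex_Re_le_cmod[of z] by (intro powr_mono) (auto simp: r_def)
        ultimately show "norm ((1 + z) * (omega_ratio z L - c) * exp (z * of_real (ln L))) \<le> 2 * (B * r * L powr (2 * r - 1)) * L powr r"
          unfolding norm_mult using L c[OF L] B r norm_exp_mult_ln[of L z]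
          by (intro mult_mono) auto
      qed
      also have "\<dots> = 2 * C * r * (L powr r * L powr (-1)) + 2 * B * r * (L powr (2 * r - 1) * L powr r)"
        using L by (simp add: powr_minus_divide)
      also have "\<dots> = 2 * C * r * L powr (r - 1) + 2 * B * r * L powr (3 * r - 1)"
        unfolding powr_add[symmetric] by (simp add: algebra_simps)
      also have "\<dots> \<le> 2 * C * r * L powr (3 * r - 1) + 2 * B * r * L powr (3 * r - 1)"
        using L r C by (intro add_right_mono mult_left_mono powr_mono) auto
      finally show ?thesis by (simp add: r_def algebra_simps)
    qed
    then show "\<exists>c. \<forall>L\<ge>1. norm (omega_sum z L - c * exp (z * of_real (ln L))) \<le> (2 * B + 2 * C) * norm z * L powr (3 * norm z - 1)"
      by blast
  qed (use B C in auto)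
qed

subsection \<open>The leading constant\<close>

text \<open>These integrands dominate in both limit interchanges below. The open half-line agrees
  with the complex Gamma integral that supplies the limit.\<close>

lemma integrable_powr_exp:
  fixes x :: real
  assumes "x > 0"
  shows "(\<lambda>t. t powr (x - 1) * exp (- t)) integrable_on {0<..}"
proof -
  have "(\<lambda>t. t powr (x - 1) / exp t) integrable_on {0..}"
    using Gamma_integral_real[OF assms] by (rule has_integral_integrable)
  then have "(\<lambda>t. t powr (x - 1) / exp t) integrable_on {0<..}"
  proof (rule integrable_spike_set)
    show "negligible {t \<in> {0..} - {0<..}. t powr (x - 1) / exp t \<noteq> 0}"
      by (rule negligible_subset[of "{0}"]) auto
    show "negligible {t \<in> {0<..} - {0..}. t powr (x - 1) / exp t \<noteq> 0}"
      by (rule negligible_subset[of "{}"]) auto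
  qed
  then show ?thesis by (simp add: exp_minus divide_inverse)
qed

lemma has_integral_exp_tail:
  fixes m :: real
  assumes m: "m > 0" and n: "n \<ge> (1::nat)"
  shows "((\<lambda>t. if ln (real n) \<le> t * m then exp (- t) else 0) has_integral real n powr (- (1 / m))) {0<..}"
proof -
  have "((\<lambda>t. exp (- 1 * t)) has_integral exp (- 1 * (ln (real n) / m)) / 1) {ln (real n) / m..}"
    by (rule has_integral_exp_minus_to_infinity) simp
  moreover have "{ln (real n) / m..} \<subseteq> {0..}" using m n by auto
  ultimately have "((\<lambda>t. if t \<in> {ln (real n) / m..} then exp (- t) else 0) has_integral exp (- (ln (real n) / m))) {0..}"
    by (subst has_integral_restrict) auto
  moreover have "exp (- (ln (real n) / m)) = real n powr (- (1 / m))" using n by (simp add: powr_def)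
  moreover have "t \<in> {ln (real n) / m..} \<longleftrightarrow> ln (real n) \<le> t * m" for t
    using m by (simp add: field_simps)
  ultimately have "((\<lambda>t. if ln (real n) \<le> t * m then exp (- t) else 0) has_integral real n powr (- (1 / m))) {0..}"
    by simp
  then show ?thesis
  proof (subst has_integral_spike_set_eq[where T = "{0..}"])
    show "negligible {t \<in> {0<..} - {0..}. (if ln (real n) \<le> t * m then exp (- t) else 0) \<noteq> 0}"
      by (rule negligible_subset[of "{}"]) auto
    show "negligible {t \<in> {0..} - {0<..}. (if ln (real n) \<le> t * m then exp (- t) else 0) \<noteq> 0}"
      by (rule negligible_subset[of "{0}"]) auto
  qed
qed

text \<open>The Dirichlet series as a Laplace transform of S: the term of n enters at t = ln n / m
  and integrates to n^(-1/m) times its coefficient.\<close>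

lemma has_integral_omega_sum:
  fixes m :: real
  assumes z: "norm z \<le> 1" and m: "m > 0"
  shows "((\<lambda>t. omega_sum z (t * m) * of_real (exp (- t))) has_integral omega_dirichlet z (1 / m)) {0<..}"
proof -
  obtain K where K: "K \<ge> 1" "\<And>r L. 0 \<le> r \<Longrightarrow> r \<le> 1 \<Longrightarrow> L > 0 \<Longrightarrow>
    (\<Sum>n=1..nat \<lfloor>exp L\<rfloor>. r ^ bigomega n / real n) \<le> K * (1 + L) powr r"
    using bigomega_sum_le by metis
  define h where "h = (\<lambda>N t. \<Sum>n=1..N. z ^ bigomega n / of_nat n * complex_of_real (if ln (real n) \<le> t * m then exp (- t) else 0))"
  have h: "(h N has_integral (\<Sum>n=1..N. z ^ bigomega n / of_nat n * complex_of_real (real n powr (- (1 / m))))) {0<..}" for N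
    unfolding h_def
    by (intro has_integral_sum has_integral_mult_right
          has_integral_linear[OF has_integral_exp_tail bounded_linear_of_real, unfolded o_def]) (use m in auto)
  \<comment> \<open>This is K (1 + t m) e^(-t), Rankin's bound at r = 1, split into the integrands
    of Gamma(1) and Gamma(2).\<close>
  let ?H = "\<lambda>t. K * (t powr (1 - 1) * exp (- t)) + K * m * (t powr (2 - 1) * exp (- t))"
  have H: "?H integrable_on {0<..}"
    by (intro integrable_add integrable_on_mult_right integrable_powr_exp) auto
  have le: "norm (h N t) \<le> ?H t" if "t \<in> {0<..}" for N t
  proof -
    from that have t: "t > 0" by simp
    have "norm (h N t) \<le> (\<Sum>n=1..N. norm (z ^ bigomega n / of_nat n * complex_of_real (if ln (real n) \<le> t * m then exp (- t) else 0)))"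
      unfolding h_def by (rule norm_sum)
    also have "\<dots> \<le> (\<Sum>n=1..N. if ln (real n) \<le> t * m then 1 / real n * exp (- t) else 0)"
    proof (rule sum_mono)
      fix n
      have "norm (z ^ bigomega n / of_nat n) \<le> 1 / real n"
        using z by (simp add: norm_divide norm_power power_le_one divide_right_mono)
      from mult_right_mono[OF this, of "exp (- t)"]
      show "norm (z ^ bigomega n / of_nat n * complex_of_real (if ln (real n) \<le> t * m then exp (- t) else 0))
        \<le> (if ln (real n) \<le> t * m then 1 / real n * exp (- t) else 0)"
        by (auto simp only: norm_mult norm_of_real abs_exp_cancel split: if_splits) simp
    qed
    also have "\<dots> = (\<Sum>n\<in>{n\<in>{1..N}. ln (real n) \<le> t * m}. 1 / real n * exp (- t))"
      by (simp only: sum.inter_filter finite_atLeastAtMost)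
    also have "\<dots> \<le> (\<Sum>n=1..nat \<lfloor>exp (t * m)\<rfloor>. 1 / real n * exp (- t))"
    proof (rule sum_mono2)
      show "{n\<in>{1..N}. ln (real n) \<le> t * m} \<subseteq> {1..nat \<lfloor>exp (t * m)\<rfloor>}"
        by (auto simp: le_nat_floor_exp_iff)
    qed auto
    also have "\<dots> = (\<Sum>n=1..nat \<lfloor>exp (t * m)\<rfloor>. 1 ^ bigomega n / real n) * exp (- t)"
      by (simp add: sum_distrib_right)
    also have "\<dots> \<le> K * (1 + t * m) powr 1 * exp (- t)"
      using t m by (intro mult_right_mono K(2)) auto
    also have "\<dots> = ?H t" using t m by (simp add: algebra_simps)
    finally show ?thesis .
  qed
  have conv: "(\<lambda>N. h N t) \<longlonglongrightarrow> omega_sum z (t * m) * of_real (exp (- t))" for t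
  proof (rule tendsto_eventually)
    show "\<forall>\<^sub>F N in sequentially. h N t = omega_sum z (t * m) * of_real (exp (- t))"
      using eventually_ge_at_top[of "nat \<lfloor>exp (t * m)\<rfloor>"]
    proof eventually_elim
      case (elim N)
      have "h N t = (\<Sum>n=1..nat \<lfloor>exp (t * m)\<rfloor>. z ^ bigomega n / of_nat n * complex_of_real (if ln (real n) \<le> t * m then exp (- t) else 0))"
        unfolding h_def
        by (rule sum.mono_neutral_right) (use elim in \<open>auto simp: le_nat_floor_exp_iff not_le\<close>)
      also have "\<dots> = (\<Sum>n=1..nat \<lfloor>exp (t * m)\<rfloor>. z ^ bigomega n / of_nat n * complex_of_real (exp (- t)))"
      proof (rule sum.cong)
        fix n assume "n \<in> {1..nat \<lfloor>exp (t * m)\<rfloor>}"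
        then have "ln (real n) \<le> t * m" using le_nat_floor_exp_iff[of n "t * m"] by simp
        then show "z ^ bigomega n / of_nat n * complex_of_real (if ln (real n) \<le> t * m then exp (- t) else 0)
          = z ^ bigomega n / of_nat n * complex_of_real (exp (- t))" by simp
      qed simp
      also have "\<dots> = omega_sum z (t * m) * of_real (exp (- t))"
        by (simp only: omega_sum_def sum_distrib_right)
      finally show ?case .
    qed
  qed
  define g where "g = (\<lambda>t. omega_sum z (t * m) * complex_of_real (exp (- t)))"
  have int: "h N integrable_on {0<..}" for N using h by (rule has_integral_integrable)
  have "(\<lambda>N. h N t) \<longlonglongrightarrow> g t" for t unfolding g_def by (rule conv)
  note dc = dominated_convergence[OF int H le this]
  have "1 / m > 0" using m by simp
  from summable_norm_cancel[OF omega_dirichlet_euler(2)[OF z this]]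
  have "summable (\<lambda>n. z ^ bigomega n * of_real (real n powr (-(1 + 1 / m))))" .
  then have "(\<lambda>N. \<Sum>n\<le>N. z ^ bigomega n * complex_of_real (real n powr (-(1 + 1 / m)))) \<longlonglongrightarrow> omega_dirichlet z (1 / m)"
    unfolding omega_dirichlet_def by (rule summable_LIMSEQ')
  also have "(\<lambda>N. \<Sum>n\<le>N. z ^ bigomega n * complex_of_real (real n powr (-(1 + 1 / m)))) = (\<lambda>N. integral {0<..} (h N))"
  proof
    fix N
    have "(\<Sum>n\<le>N. z ^ bigomega n * complex_of_real (real n powr (-(1 + 1 / m)))) =
      (\<Sum>n=1..N. z ^ bigomega n * complex_of_real (real n powr (-(1 + 1 / m))))"
      by (rule sum.mono_neutral_right) (auto simp: Suc_le_eq)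
    also have "\<dots> = (\<Sum>n=1..N. z ^ bigomega n / of_nat n * complex_of_real (real n powr (- (1 / m))))"
    proof (rule sum.cong)
      fix n assume "n \<in> {1..N}"
      then have "real n powr (-(1 + 1 / m)) = real n powr (- (1 / m)) / real n"
        by (simp add: powr_diff powr_minus_divide powr_add)
      then show "z ^ bigomega n * complex_of_real (real n powr (-(1 + 1 / m))) =
         z ^ bigomega n / of_nat n * complex_of_real (real n powr (- (1 / m)))" by simp
    qed simp
    also have "\<dots> = integral {0<..} (h N)" using h[of N] by (rule integral_unique[symmetric])
    finally show "(\<Sum>n\<le>N. z ^ bigomega n * complex_of_real (real n powr (-(1 + 1 / m)))) = integral {0<..} (h N)" .
  qed
  finally have "integral {0<..} g = omega_dirichlet z (1 / m)"
    using dc(2) LIMSEQ_unique by blast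
  with dc(1) have "(g has_integral omega_dirichlet z (1 / m)) {0<..}" by (simp add: has_integral_iff)
  then show ?thesis by (simp only: g_def)
qed

text \<open>After scaling by m^(-z), the integrand m^(-z) S(t m) e^(-t) tends to c t^z e^(-t), whose
  integral is c Gamma(1 + z). The work lies in a majorant that does not depend on m.\<close>

lemma omega_dirichlet_abelian:
  fixes z c :: complex
  assumes z: "norm z \<le> 1/8"
    and c: "\<And>L. L \<ge> 1 \<Longrightarrow> norm (omega_sum z L - c * exp (z * of_real (ln L))) \<le> D * L powr (3 * norm z - 1)"
  shows "(\<lambda>k. exp (- z * of_real (ln (real (Suc k)))) * omega_dirichlet z (1 / real (Suc k))) \<longlonglongrightarrow> c * Gamma (1 + z)"
proof -
  have Re: "- (1/8) \<le> Re z" "Re z \<le> 1/8" using abs_Re_le_cmod[of z] z by linarith+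
  have D: "D \<ge> 0"
  proof -
    have "0 \<le> D * 1 powr (3 * norm z - 1)" by (rule order_trans[OF norm_ge_zero c]) simp
    then show ?thesis by simp
  qed
  obtain K where K: "K \<ge> 0" "\<And>z L. norm z \<le> 1 \<Longrightarrow> L > 0 \<Longrightarrow> norm (omega_sum z L) \<le> K * (1 + L) powr norm z"
    using omega_sum_bounds by metis
  define B where "B = norm c + D + 2 * K"
  have B: "B \<ge> 0" using D K by (simp add: B_def)
  define f where "f = (\<lambda>k t. exp (- z * of_real (ln (real (Suc k)))) * (omega_sum z (t * real (Suc k)) * of_real (exp (- t))))"
  define g where "g = (\<lambda>t. c * (of_real t powr (1 + z - 1) / of_real (exp t)))"
  \<comment> \<open>Since |Re z| \<le> 1/8, the power t^(Re z) lies below t^(-1/8) + t^(1/8), giving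
    integrands of Gamma(7/8) and Gamma(9/8).\<close>
  let ?H = "\<lambda>t. B * (t powr (7/8 - 1) * exp (- t)) + B * (t powr (9/8 - 1) * exp (- t))"
  have f: "(f k has_integral exp (- z * of_real (ln (real (Suc k)))) * omega_dirichlet z (1 / real (Suc k))) {0<..}" for k
    unfolding f_def by (intro has_integral_mult_right has_integral_omega_sum) (use z in auto)
  have g: "(g has_integral c * Gamma (1 + z)) {0<..}"
    unfolding g_def by (intro has_integral_mult_right Gamma_integral_complex') (use Re in simp)
  have H: "?H integrable_on {0<..}"
    by (intro integrable_add integrable_on_mult_right integrable_powr_exp) auto
  have le: "norm (f k t) \<le> ?H t" if "t \<in> {0<..}" for k t
  proof -
    from that have t: "t > 0" by simp
    define m where "m = real (Suc k)"
    have m: "m \<ge> 1" by (simp add: m_def)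
    have "m powr (- Re z) * norm (omega_sum z (t * m)) \<le> B * t powr (7/8 - 1) + B * t powr (9/8 - 1)"
    proof (cases "t * m \<ge> 1")
      case True
      have "norm (omega_sum z (t * m)) \<le> norm (omega_sum z (t * m) - c * exp (z * of_real (ln (t * m)))) + norm (c * exp (z * of_real (ln (t * m))))"
        by (metis diff_add_cancel norm_triangle_ineq)
      also have "\<dots> \<le> D * (t * m) powr (3 * norm z - 1) + norm c * (t * m) powr Re z"
        unfolding norm_mult[of c] by (subst norm_exp_mult_ln) (use c[OF True] t m in auto)
      \<comment> \<open>3|z| - 1 \<le> Re z because 4|z| \<le> 1, so the error is no larger than the
        main term.\<close>
      also have "\<dots> \<le> D * (t * m) powr Re z + norm c * (t * m) powr Re z"
        using D True Re z by (intro add_right_mono mult_left_mono powr_mono) auto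
      also have "\<dots> \<le> B * (t * m) powr Re z"
        unfolding B_def using K by (simp add: algebra_simps)
      finally have "m powr (- Re z) * norm (omega_sum z (t * m)) \<le> m powr (- Re z) * (B * (t * m) powr Re z)"
        by (intro mult_left_mono) auto
      also have "\<dots> = B * t powr Re z"
        using t m by (simp add: powr_mult powr_minus field_simps)
      also have "B * t powr Re z \<le> B * (t powr (7/8 - 1) + t powr (9/8 - 1))"
      proof (rule mult_left_mono[OF _ B])
        show "t powr Re z \<le> t powr (7/8 - 1) + t powr (9/8 - 1)"
        proof (cases "t \<ge> 1")
          case True
          then have "t powr Re z \<le> t powr (9/8 - 1)" using Re by (intro powr_mono) auto
          then show ?thesis by (simp add: add_increasing)
        next
          case False
          then have "t powr Re z \<le> t powr (7/8 - 1)" using Re t by (intro powr_mono') auto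
          then show ?thesis by (simp add: add_increasing2)
        qed
      qed
      finally show ?thesis by (simp only: distrib_left)
    next
      case False
      have "norm (omega_sum z (t * m)) \<le> K * (1 + t * m) powr norm z" using z t m by (intro K(2)) auto
      also have "\<dots> \<le> K * 2 powr 1"
      proof (intro mult_left_mono K)
        have "(1 + t * m) powr norm z \<le> 2 powr norm z" using False t m by (intro powr_mono2) auto
        also have "\<dots> \<le> 2 powr 1" using z by (intro powr_mono) auto
        finally show "(1 + t * m) powr norm z \<le> 2 powr 1" .
      qed
      also have "\<dots> \<le> B" using D by (simp add: B_def)
      finally have 1: "norm (omega_sum z (t * m)) \<le> B" .
      have "m powr (- Re z) \<le> m powr (1/8)" using m Re by (intro powr_mono) auto
      also have "\<dots> \<le> (1 / t) powr (1/8)" using False t m by (intro powr_mono2) (auto simp: field_simps)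
      also have "\<dots> = t powr (7/8 - 1)" using t by (simp add: powr_divide powr_minus_divide)
      finally have "m powr (- Re z) * norm (omega_sum z (t * m)) \<le> t powr (7/8 - 1) * B"
        using 1 by (intro mult_mono) auto
      moreover have "0 \<le> B * t powr (9/8 - 1)" using B by simp
      ultimately show ?thesis by (simp add: mult.commute)
    qed
    then have "m powr (- Re z) * norm (omega_sum z (t * m)) * exp (- t) \<le> (B * t powr (7/8 - 1) + B * t powr (9/8 - 1)) * exp (- t)"
      by (rule mult_right_mono) simp
    moreover have "norm (f k t) = m powr (- Re z) * norm (omega_sum z (t * m)) * exp (- t)"
      unfolding f_def m_def[symmetric] norm_mult using norm_exp_mult_ln[of m "- z"] m by simp
    ultimately show ?thesis by (simp add: algebra_simps)
  qed
  have conv: "(\<lambda>k. f k t) \<longlonglongrightarrow> g t" if "t \<in> {0<..}" for t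
  proof -
    from that have t: "t > 0" by simp
    let ?e = "\<lambda>k. D * t powr (3 * norm z - 1) * real (Suc k) powr (- (1 / 2)) * exp (- t)"
    have e: "?e \<longlonglongrightarrow> 0" by real_asymp
    have "norm (f k t - g t) \<le> ?e k" if k: "t * real (Suc k) \<ge> 1" for k
    proof -
      define m where "m = real (Suc k)"
      have m: "m \<ge> 1" by (simp add: m_def)
      have "exp (- z * of_real (ln m)) * exp (z * of_real (ln (t * m))) = exp (z * of_real (ln t))"
        using t m by (simp add: ln_mult exp_add[symmetric] algebra_simps)
      moreover have "g t = c * exp (z * of_real (ln t)) * of_real (exp (- t))"
        using t by (simp add: g_def powr_def Ln_of_real exp_minus divide_inverse)
      ultimately have "f k t - g t = exp (- z * of_real (ln m)) * (omega_sum z (t * m) - c * exp (z * of_real (ln (t * m)))) * of_real (exp (- t))"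
        unfolding f_def m_def[symmetric] by (simp add: algebra_simps)
      also have "norm \<dots> = m powr (- Re z) * norm (omega_sum z (t * m) - c * exp (z * of_real (ln (t * m)))) * exp (- t)"
        unfolding norm_mult using norm_exp_mult_ln[of m "- z"] m by simp
      also have "\<dots> \<le> m powr (- Re z) * (D * (t * m) powr (3 * norm z - 1)) * exp (- t)"
        using c[of "t * m"] k by (intro mult_right_mono mult_left_mono) (auto simp: m_def)
      also have "\<dots> = D * t powr (3 * norm z - 1) * m powr (- Re z + (3 * norm z - 1)) * exp (- t)"
      proof -
        have "(t * m) powr (3 * norm z - 1) = t powr (3 * norm z - 1) * m powr (3 * norm z - 1)"
          using t m by (simp add: powr_mult)
        then show ?thesis by (simp only: powr_add mult_ac)
      qed
      \<comment> \<open>The exponent of m is at most 4|z| - 1, which is at most -1/2 for |z| \<le>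
        1/8.\<close>
      also have "\<dots> \<le> D * t powr (3 * norm z - 1) * m powr (- (1/2)) * exp (- t)"
        using D m Re z by (intro mult_right_mono mult_left_mono powr_mono) auto
      finally show ?thesis by (simp add: m_def)
    qed
    moreover have "\<forall>\<^sub>F k in sequentially. t * real (Suc k) \<ge> 1"
      using eventually_ge_at_top[of "nat \<lceil>1 / t\<rceil>"]
    proof eventually_elim
      case (elim k)
      then have "1 / t \<le> real (Suc k)" by linarith
      then show ?case using t by (simp add: field_simps)
    qed
    ultimately have "\<forall>\<^sub>F k in sequentially. norm (f k t - g t) \<le> ?e k"
      by (auto elim: eventually_mono)
    then have "(\<lambda>k. f k t - g t) \<longlonglongrightarrow> 0" by (rule Lim_null_comparison[OF _ e])
    then show ?thesis by (simp add: LIM_zero_iff)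
  qed
  have "(\<lambda>k. integral {0<..} (f k)) \<longlonglongrightarrow> integral {0<..} g"
    by (rule dominated_convergence(2)[OF has_integral_integrable[OF f] H le conv])
  then show ?thesis
    using integral_unique[OF f] integral_unique[OF g] by simp
qed

text \<open>Tannery's theorem applies because the majorant 4 / p^2 does not depend on s.\<close>

lemma suminf_euler_log_tendsto:
  assumes z: "norm z \<le> 1/8"
  shows "(\<lambda>k. \<Sum>p. euler_log z (1 / real (Suc k)) p) \<longlonglongrightarrow> (\<Sum>p. euler_log z 0 p)"
proof (rule tannerys_theorem[THEN conjunct2, THEN conjunct2])
  show "(\<lambda>k. euler_log z (1 / real (Suc k)) p) \<longlonglongrightarrow> euler_log z 0 p" for p
  proof (cases "prime p")
    case True
    define u where "u = (\<lambda>k. real p powr (- (1 + 1 / real (Suc k))))"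
    have p: "real p \<ge> 2" using prime_ge_2_nat[OF True] by simp
    have "u \<longlonglongrightarrow> real p powr (- (1 + 0))"
      unfolding u_def using p by (intro tendsto_intros LIMSEQ_Suc lim_1_over_n) auto
    then have u: "u \<longlonglongrightarrow> 1 / real p" using p by (simp add: powr_minus_divide)
    \<comment> \<open>This keeps 1 - z/p away from the branch cut of \<open>ln\<close>.\<close>
    have "norm (z * of_real (1 / real p)) \<le> 1/8 * 1"
      unfolding norm_mult norm_of_real using z p by (intro mult_mono) auto
    then have "1 - z * of_real (1 / real p) \<notin> \<real>\<^sub>\<le>\<^sub>0"
      using complex_Re_le_cmod[of "z * of_real (1 / real p)"]
      by (auto simp: complex_nonpos_Reals_iff)
    then have "(\<lambda>k. z * of_real (ln (1 - u k)) - ln (1 - z * of_real (u k))) \<longlonglongrightarrow>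
       z * of_real (ln (1 - 1 / real p)) - ln (1 - z * of_real (1 / real p))"
      using p by (intro tendsto_intros u) auto
    then show ?thesis using True p by (simp add: euler_log_def u_def powr_minus_divide)
  qed (simp add: euler_log_def)
  show "\<forall>\<^sub>F (p, k) in at_top \<times>\<^sub>F sequentially. norm (euler_log z (1 / real (Suc k)) p) \<le> 4 / real p ^ 2"
    by (intro always_eventually) (use norm_euler_log_le z in auto)
qed (use summable_inverse_square in auto)

text \<open>The scaling m^(-z) cancels the pole: \<open>zeta1 (1 / m) / m\<close> lies between 1 and
  1 + 1/m, so its z-th power tends to 1.\<close>

lemma omega_dirichlet_at_1:
  assumes z: "norm z \<le> 1/8"
  shows "(\<lambda>k. exp (- z * of_real (ln (real (Suc k)))) * omega_dirichlet z (1 / real (Suc k)))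
    \<longlonglongrightarrow> exp (\<Sum>p. euler_log z 0 p)"
proof -
  have "exp (- z * of_real (ln (real (Suc k)))) * omega_dirichlet z (1 / real (Suc k)) =
    exp (\<Sum>p. euler_log z (1 / real (Suc k)) p) * exp (z * of_real (ln (zeta1 (1 / real (Suc k)) / real (Suc k))))" for k
  proof -
    have pos: "zeta1 (1 / real (Suc k)) > 0" by (rule zeta1_pos) simp
    have "exp (- z * of_real (ln (real (Suc k)))) * exp (z * of_real (ln (zeta1 (1 / real (Suc k))))) =
      exp (z * of_real (ln (zeta1 (1 / real (Suc k)) / real (Suc k))))"
      using pos unfolding exp_add[symmetric] by (simp add: ln_div algebra_simps del: of_nat_Suc)
    then show ?thesis
      using omega_dirichlet_eq[of z "1 / real (Suc k)"] z by (simp del: of_nat_Suc)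
  qed
  moreover have "(\<lambda>k. exp (\<Sum>p. euler_log z (1 / real (Suc k)) p) * exp (z * of_real (ln (zeta1 (1 / real (Suc k)) / real (Suc k)))))
    \<longlonglongrightarrow> exp (\<Sum>p. euler_log z 0 p) * exp (z * of_real (ln 1))"
  proof -
    have "(\<lambda>k. zeta1 (1 / real (Suc k)) / real (Suc k)) \<longlonglongrightarrow> 1"
    proof (rule tendsto_sandwich[of "\<lambda>_. 1" _ _ "\<lambda>k. 1 + 1 / real (Suc k)"])
      show "(\<lambda>k. 1 + 1 / real (Suc k)) \<longlonglongrightarrow> 1" by real_asymp
      show "\<forall>\<^sub>F k in sequentially. 1 \<le> zeta1 (1 / real (Suc k)) / real (Suc k)"
        using zeta1_bounds(1)[of "1 / real (Suc _)"] by (intro always_eventually) (simp add: field_simps)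
      show "\<forall>\<^sub>F k in sequentially. zeta1 (1 / real (Suc k)) / real (Suc k) \<le> 1 + 1 / real (Suc k)"
      proof (intro always_eventually allI)
        fix k
        have "zeta1 (1 / real (Suc k)) / real (Suc k) \<le> (1 + real (Suc k)) / real (Suc k)"
          using zeta1_bounds(2)[of "1 / real (Suc k)"] by (intro divide_right_mono) auto
        also have "\<dots> = 1 + 1 / real (Suc k)" by (simp add: field_simps)
        finally show "zeta1 (1 / real (Suc k)) / real (Suc k) \<le> 1 + 1 / real (Suc k)" .
      qed
    qed auto
    then show ?thesis by (intro tendsto_intros suminf_euler_log_tendsto z) auto
  qed
  ultimately show ?thesis by simp
qed

lemma nu_eq:
  assumes z: "norm z \<le> 1/8"
  shows "nu z = 1 / Gamma (z + 1) * exp (\<Sum>p. euler_log z 0 p)"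
proof -
  have "(if prime p then inverse (1 - z / of_nat p) * (1 - 1 / of_nat p) powr z else 1) = exp (euler_log z 0 p)" for p
  proof (cases "prime p")
    case True
    have p: "real p \<ge> 2" using prime_ge_2_nat[OF True] by simp
    have u: "real p powr (- (1 + 0)) = 1 / real p" using p by (simp add: powr_minus_divide)
    have "norm (z * of_real (1 / real p)) \<le> 1/8 * 1"
      unfolding norm_mult norm_of_real using z p by (intro mult_mono) auto
    then have nz: "1 - z / of_nat p \<noteq> 0" by auto
    have "(1 - 1 / of_nat p) powr z = complex_of_real (1 - 1 / real p) powr z" by simp
    also have "\<dots> = exp (z * of_real (ln (1 - 1 / real p)))"
      unfolding powr_def using p by (subst Ln_of_real) auto
    finally show ?thesis
      using True exp_euler_log[of z 0 p] z nz p unfolding u by (simp add: field_simps)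
  qed (simp add: euler_log_def)
  moreover have "(\<Prod>p. exp (euler_log z 0 p)) = exp (\<Sum>p. euler_log z 0 p)"
  \<comment> \<open>The infinite product may be computed from its partial products since their
    limit, an exponential, is nonzero.\<close>
  proof (rule prodinf_eq_prod_lim)
    have "(\<lambda>n. exp (\<Sum>p\<le>n. euler_log z 0 p)) \<longlonglongrightarrow> exp (\<Sum>p. euler_log z 0 p)"
      using z by (intro tendsto_intros summable_LIMSEQ' summable_euler_log) auto
    then show "(\<lambda>n. \<Prod>p\<le>n. exp (euler_log z 0 p)) \<longlonglongrightarrow> exp (\<Sum>p. euler_log z 0 p)"
      by (simp add: exp_sum)
  qed simp
  ultimately show ?thesis by (simp add: nu_def)
qed

text \<open>The scaled Dirichlet series has two limits, c Gamma(1 + z) from the asymptotics and an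
  Euler product from the factorization. Equating them shows c = \<open>nu z\<close>.\<close>

lemma omega_sum_asymp:
  obtains C where "C \<ge> 0" "\<And>z L. norm z \<le> 1/8 \<Longrightarrow> L \<ge> 1 \<Longrightarrow>
     norm (omega_sum z L - nu z * exp (z * of_real (ln L))) \<le> C * norm z * L powr (3 * norm z - 1)"
proof -
  obtain C where C: "C \<ge> 0" "\<And>z. norm z \<le> 1/4 \<Longrightarrow> \<exists>c. \<forall>L\<ge>1.
     norm (omega_sum z L - c * exp (z * of_real (ln L))) \<le> C * norm z * L powr (3 * norm z - 1)"
    using omega_sum_asymp_ex by metis
  show thesis
  proof (rule that[OF C(1)])
    fix z :: complex and L :: real assume z: "norm z \<le> 1/8" and L: "L \<ge> 1"
    then obtain c where c: "\<And>L. L \<ge> 1 \<Longrightarrow>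
        norm (omega_sum z L - c * exp (z * of_real (ln L))) \<le> C * norm z * L powr (3 * norm z - 1)"
      using C(2)[of z] by auto
    have "c * Gamma (1 + z) = exp (\<Sum>p. euler_log z 0 p)"
      using omega_dirichlet_abelian[OF z c] omega_dirichlet_at_1[OF z] by (rule LIMSEQ_unique)
    moreover have "Gamma (1 + z) \<noteq> 0"
    proof -
      have "Re (1 + z) > 0" using abs_Re_le_cmod[of z] z by simp
      then have "1 + z \<notin> \<int>\<^sub>\<le>\<^sub>0"
        by (metis Re_complex_of_real nonpos_Ints_cases of_int_le_0_iff of_real_of_int_eq not_less)
      then show ?thesis by (simp add: Gamma_eq_zero_iff)
    qed
    ultimately have "nu z = c" unfolding nu_eq[OF z] by (simp add: field_simps add.commute)
    with c[OF L] show "norm (omega_sum z L - nu z * exp (z * of_real (ln L))) \<le> C * norm z * L powr (3 * norm z - 1)"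
      by simp
  qed
qed

subsection \<open>Coefficient extraction\<close>

lemma omega_sum_holomorphic: "(\<lambda>z. omega_sum z L) holomorphic_on A"
  unfolding omega_sum_def by (intro holomorphic_intros) auto

text \<open>By the uniform asymptotics, \<open>nu\<close> is a uniform limit of the entire functions
  m^(-z) S(m). For |z| \<le> 1/8 the error has exponent (3/8 - 1) + 1/8 = -1/2.\<close>

lemma nu_holomorphic: "nu holomorphic_on ball 0 (1/8)"
proof -
  obtain C where C: "C \<ge> 0" "\<And>z L. norm z \<le> 1/8 \<Longrightarrow> L \<ge> 1 \<Longrightarrow>
     norm (omega_sum z L - nu z * exp (z * of_real (ln L))) \<le> C * norm z * L powr (3 * norm z - 1)"
    using omega_sum_asymp by metis
  define f where "f = (\<lambda>k z. omega_sum z (real (Suc k)) * exp (- z * of_real (ln (real (Suc k)))))"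
  have bound: "norm (f k z - nu z) \<le> C * real (Suc k) powr (-1/2)" if z: "norm z \<le> 1/8" for k z
  proof -
    define L where "L = real (Suc k)"
    have L: "L \<ge> 1" by (simp add: L_def)
    have "exp (z * of_real (ln L)) * exp (- z * of_real (ln L)) = 1"
      by (simp add: exp_add[symmetric])
    then have "f k z - nu z = (omega_sum z L - nu z * exp (z * of_real (ln L))) * exp (- z * of_real (ln L))"
      unfolding f_def L_def[symmetric] by (simp add: algebra_simps)
    also have "norm \<dots> = norm (omega_sum z L - nu z * exp (z * of_real (ln L))) * L powr (- Re z)"
      unfolding norm_mult using norm_exp_mult_ln[of L "- z"] L by simp
    also have "\<dots> \<le> (C * norm z * L powr (3 * norm z - 1)) * L powr (1/8)"
      using C z L abs_Re_le_cmod[of z] by (intro mult_mono powr_mono) auto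
    also have "\<dots> \<le> (C * 1 * L powr (- 5/8)) * L powr (1/8)"
      using C z L by (intro mult_right_mono mult_mono powr_mono) auto
    also have "\<dots> = C * (L powr (- 5/8) * L powr (1/8))" by simp
    also have "L powr (- 5/8) * L powr (1/8) = L powr (-1/2)"
      unfolding powr_add[symmetric] by simp
    finally show ?thesis by (simp add: L_def)
  qed
  have lim: "(\<lambda>k. C * real (Suc k) powr (-1/2)) \<longlonglongrightarrow> 0" by real_asymp
  have unif: "uniform_limit (ball 0 (1/8)) f nu sequentially"
  proof (rule uniform_limitI)
    fix e :: real assume "e > 0"
    with lim have "\<forall>\<^sub>F k in sequentially. C * real (Suc k) powr (-1/2) < e"
      by (rule order_tendstoD)
    then show "\<forall>\<^sub>F k in sequentially. \<forall>z\<in>ball 0 (1/8). dist (f k z) (nu z) < e"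
    proof eventually_elim
      case (elim k)
      show ?case
      proof
        fix z :: complex assume "z \<in> ball 0 (1/8)"
        then have "norm z \<le> 1/8" by simp
        from bound[OF this, of k] elim show "dist (f k z) (nu z) < e" by (simp add: dist_norm)
      qed
    qed
  qed
  show ?thesis
  proof (rule holomorphic_uniform_sequence[of _ f])
    show "f k holomorphic_on ball 0 (1/8)" for k
      unfolding f_def by (intro holomorphic_intros omega_sum_holomorphic)
    fix x :: complex assume "x \<in> ball 0 (1/8)"
    then obtain d where "d > 0" "cball x d \<subseteq> ball 0 (1/8)"
      using open_contains_cball[of "ball 0 (1/8) :: complex set"] by (metis open_ball)
    with unif show "\<exists>d>0. cball x d \<subseteq> ball 0 (1/8) \<and> uniform_limit (cball x d) f nu sequentially"
      using uniform_limit_on_subset by blast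
  qed auto
qed

lemma omega_sum_coeff:
  assumes "x > 0"
  shows "(\<Sum>n=1..nat \<lfloor>exp (ln x)\<rfloor>. if bigomega n = k then 1 / real n else 0) = almost_prime_recip_sum k x"
proof -
  have "(\<Sum>n=1..nat \<lfloor>exp (ln x)\<rfloor>. if bigomega n = k then 1 / real n else 0) =
    (\<Sum>n\<in>{n\<in>{1..nat \<lfloor>x\<rfloor>}. bigomega n = k}. 1 / real n)"
    unfolding exp_ln[OF assms] by (rule sum.inter_filter [symmetric]) simp
  also have "{n\<in>{1..nat \<lfloor>x\<rfloor>}. bigomega n = k} = {n. 0 < n \<and> real n \<le> x \<and> bigomega n = k}"
    using assms by (auto simp: le_nat_iff le_floor_iff Suc_le_eq)
  finally show ?thesis by (simp add: almost_prime_recip_sum_def)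
qed

text \<open>As a function of z, \<open>omega_sum\<close> is a polynomial whose k-th coefficient
  collects the n with \<open>bigomega n = k\<close>. The finite sum on the right is the Cauchy
  product of the series of \<open>nu\<close> and of the exponential.\<close>

lemma higher_deriv_error:
  assumes "x > 0"
  shows "(deriv ^^ k) (\<lambda>z. omega_sum z (ln x) - nu z * exp (z * of_real l)) 0 / fact k =
    of_real (almost_prime_recip_sum k x) - (\<Sum>j=0..k. nu_coeff (k - j) / fact j * of_real l ^ j)"
proof -
  define N where "N = fps_expansion nu 0"
  have "nu analytic_on {0}"
    using nu_holomorphic by (rule holomorphic_on_imp_analytic_at) auto
  then have N: "nu has_fps_expansion N"
    unfolding N_def by (rule analytic_at_imp_has_fps_expansion_0)
  have Nk: "fps_nth N j = nu_coeff j" for j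
    by (simp add: N_def fps_expansion_def nu_coeff_def)
  let ?A = "\<Sum>n=1..nat \<lfloor>exp (ln x)\<rfloor>. fps_X ^ bigomega n * fps_const (1 / complex_of_nat n)"
  have "(\<lambda>z. (\<Sum>n=1..nat \<lfloor>exp (ln x)\<rfloor>. z ^ bigomega n * (1 / of_nat n)) - exp (of_real l * z) * nu z)
     has_fps_expansion ?A - fps_exp (of_real l) * N"
    by (intro fps_expansion_intros N)
  then have "(\<lambda>z. omega_sum z (ln x) - nu z * exp (z * of_real l)) has_fps_expansion ?A - fps_exp (of_real l) * N"
    by (simp add: omega_sum_def mult.commute)
  then have "(deriv ^^ k) (\<lambda>z. omega_sum z (ln x) - nu z * exp (z * of_real l)) 0 / fact k = fps_nth (?A - fps_exp (of_real l) * N) k"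
    by (rule fps_nth_fps_expansion[symmetric])
  also have "\<dots> = (\<Sum>n=1..nat \<lfloor>exp (ln x)\<rfloor>. of_real (if bigomega n = k then 1 / real n else 0))
     - (\<Sum>j=0..k. nu_coeff (k - j) / fact j * of_real l ^ j)"
  proof -
    have "fps_nth (fps_X ^ bigomega n * fps_const (1 / complex_of_nat n)) k = of_real (if bigomega n = k then 1 / real n else 0)" for n
      by (simp add: fps_mult_right_const_nth fps_X_power_nth)
    moreover have "fps_nth (fps_exp (of_real l) * N) k = (\<Sum>j=0..k. nu_coeff (k - j) / fact j * of_real l ^ j)"
      unfolding fps_mult_nth Nk by (simp add: mult_ac)
    ultimately show ?thesis by (simp only: fps_sub_nth fps_sum_nth)
  qed
  also have "(\<Sum>n=1..nat \<lfloor>exp (ln x)\<rfloor>. of_real (if bigomega n = k then 1 / real n else 0))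
     = complex_of_real (almost_prime_recip_sum k x)"
    unfolding of_real_sum[symmetric] omega_sum_coeff[OF assms] ..
  finally show ?thesis .
qed

theorem theorem1p1:
  fixes k :: nat
  assumes "k \<ge> 1"
  shows "\<exists>C::real. \<forall>x::real. x \<ge> 3 \<longrightarrow>
    norm (complex_of_real (almost_prime_recip_sum k x)
          - (\<Sum>j=0..k. nu_coeff (k - j) / fact j * complex_of_real (ln (ln x)) ^ j))
      \<le> C * (ln (ln x) ^ (k - 1) / ln x)"
proof -
  obtain C where C: "C \<ge> 0" "\<And>z L. norm z \<le> 1/8 \<Longrightarrow> L \<ge> 1 \<Longrightarrow>
     norm (omega_sum z L - nu z * exp (z * of_real (ln L))) \<le> C * norm z * L powr (3 * norm z - 1)"
    using omega_sum_asymp by metis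
  \<comment> \<open>A positive lower bound for ln ln x on x \<ge> 3, by which 1 + l can be replaced
    by a multiple of l at the end.\<close>
  define l0 where "l0 = ln (ln (3::real))"
  have ln3: "ln (3::real) > 1"
    using ln3_gt_1 by simp
  then have l0: "l0 > 0" by (simp add: l0_def)
  define B where "B = C * exp 1 * (16 * (1 / l0 + 1)) ^ (k - 1)"
  show ?thesis
  proof (intro exI[of _ B] allI impI)
    fix x :: real assume x: "x \<ge> 3"
    define L where "L = ln x"
    define l where "l = ln L"
    \<comment> \<open>Then 3 r l < 1, so L^(3r) \<le> e on the circle, and r \<le> 1/16 keeps the
      closed disc inside the domain of holomorphy.\<close>
    define r where "r = 1 / (16 * (1 + l))"
    have "L \<ge> ln 3" using x by (simp add: L_def)
    then have L: "L > 1" and l: "l \<ge> l0" using ln3 by (auto simp: l_def l0_def)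
    then have lpos: "l > 0" using l0 by simp
    have r: "r > 0" "r \<le> 1/16" using lpos by (auto simp: r_def field_simps)
    define E where "E = (\<lambda>z. omega_sum z L - nu z * exp (z * of_real l))"
    have hol: "E holomorphic_on ball 0 (1/8)"
      unfolding E_def by (intro holomorphic_intros omega_sum_holomorphic nu_holomorphic)
    have "norm ((deriv ^^ k) E 0) \<le> fact k * (C * r * exp 1 / L) / r ^ k"
    proof (rule Cauchy_inequality)
      show "E holomorphic_on ball 0 r"
        by (rule holomorphic_on_subset[OF hol]) (use r in auto)
      show "continuous_on (cball 0 r) E"
        by (rule continuous_on_subset[OF holomorphic_on_imp_continuous_on[OF hol]]) (use r in auto)
      fix z :: complex assume "norm (0 - z) = r"
      then have z: "norm z = r" by simp
      have "norm (E z) \<le> C * norm z * L powr (3 * norm z - 1)"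
        unfolding E_def l_def using z r L by (intro C(2)) auto
      also have "\<dots> = C * r * (L powr (3 * r) / L)"
        using L by (simp add: z powr_diff)
      also have "L powr (3 * r) \<le> exp 1"
        using L lpos unfolding powr_def l_def[symmetric] by (simp add: r_def field_simps)
      finally show "norm (E z) \<le> C * r * exp 1 / L"
        using C r L by (simp add: mult_left_mono divide_right_mono)
    qed (use r in auto)
    then have "norm ((deriv ^^ k) E 0 / fact k) \<le> C * r * exp 1 / L / r ^ k"
      by (simp add: norm_divide field_simps)
    \<comment> \<open>The factor |z| = r of the error cancels one power of r, which is possible
      since k \<ge> 1 and lowers the exponent to k - 1.\<close>
    also have "\<dots> = C * exp 1 * (1 / r) ^ (k - 1) / L"
    proof -
      have "r ^ k = r * r ^ (k - 1)" using assms by (simp add: power_eq_if)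
      then show ?thesis using r by (simp add: field_simps)
    qed
    also have "1 / r = 16 * (1 + l)" by (simp add: r_def)
    also have "C * exp 1 * (16 * (1 + l)) ^ (k - 1) / L \<le> C * exp 1 * (16 * (1 / l0 + 1) * l) ^ (k - 1) / L"
    proof -
      have "1 \<le> l / l0" using l l0 by simp
      then have "16 * (1 + l) \<le> 16 * (l / l0 + l)" by (intro mult_left_mono add_right_mono) simp_all
      also have "\<dots> = 16 * (1 / l0 + 1) * l" by (simp add: algebra_simps)
      finally have "16 * (1 + l) \<le> 16 * (1 / l0 + 1) * l" .
      then show ?thesis using C L lpos by (intro divide_right_mono mult_left_mono power_mono) auto
    qed
    also have "\<dots> = B * (l ^ (k - 1) / L)" by (simp add: B_def power_mult_distrib)
    finally show "norm (complex_of_real (almost_prime_recip_sum k x)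
          - (\<Sum>j=0..k. nu_coeff (k - j) / fact j * complex_of_real (ln (ln x)) ^ j)) \<le> B * (ln (ln x) ^ (k - 1) / ln x)"
      using higher_deriv_error[of x k l] x unfolding E_def L_def l_def by simp
  qed
qed

end
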